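(* Let $X$ and $Y$ be infinite compact spaces and let $Z$ be a metrizable space containing a homeomorphic copy of $\mathbb R$. Then a compact space $K$ embeds homeomorphically into $S(X\times Y,Z)$ if and only if $w(K)<\min\{c^\sharp(X),c^\sharp(Y)\}$.
   Context: All compact spaces are assumed Hausdorff. For topological spaces $X,Y,Z$, a function $f:X\times Y\to Z$ is separately continuous if $y\mapsto f(x,y)$ is continuous for every $x\in X$ and $x\mapsto f(x,y)$ is continuous for every $y\in Y$. $S(X\times Y,Z)$ denotes the set of all separately continuous functions $X\times Y\to Z$. For $p=(a,b)\in X\times Y$, the cross of $p$ is $\mathrm{cr}\{p\}=(\{a\}\times Y)\cup(X\times\{b\})$. For $X,Y$ compact and $Z$ metrizable with a compatible metric $d$, $S(X\times Y,Z)$ carries the topology generated by the family of extended pseudometrics $d_c(s,t)=\sup_{p\in\mathrm{cr}\{c\}} d(s(p),t(p))$, $c\in X\times Y$ (the cross-uniform topology); it coincides with the cross-open topology, generated by the subbase of sets $\{s: s(A)\subseteq W\}$ with $W$ open in $Z$ and $A=\overline{G}\cap C$, where $C=\mathrm{cr}\{p\}$ for some $p$ and $G$ is open in $C$. $w(K)$ is the weight of $K$. The sharp cellularity is $c^\sharp(X)=\sup\{|\mathcal U|^+:\mathcal U$ a family of pairwise disjoint open sets in $X\}$, where $\mathfrak m^+$ denotes the least cardinal greater than $\mathfrak m$. *)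

theory Defs
  imports "HOL-Analysis.Analysis"
begin

unbundle cardinal_syntax

definition sep_cont :: "'a topology \<Rightarrow> 'b topology \<Rightarrow> 'c topology \<Rightarrow> ('a \<times> 'b \<Rightarrow> 'c) set" where
  "sep_cont X Y Z = {f. f \<in> extensional (topspace X \<times> topspace Y) \<and>
      (\<forall>x\<in>topspace X. continuous_map Y Z (\<lambda>y. f (x, y))) \<and>
      (\<forall>y\<in>topspace Y. continuous_map X Z (\<lambda>x. f (x, y)))}"

definition cross :: "'a topology \<Rightarrow> 'b topology \<Rightarrow> 'a \<times> 'b \<Rightarrow> ('a \<times> 'b) set" where
  "cross X Y p = ({fst p} \<times> topspace Y) \<union> (topspace X \<times> {snd p})"

definition cross_open_subbase :: "'a topology \<Rightarrow> 'b topology \<Rightarrow> 'c topology \<Rightarrow> ('a \<times> 'b \<Rightarrow> 'c) set set" where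
  "cross_open_subbase X Y Z =
     {{s \<in> sep_cont X Y Z. s ` A \<subseteq> W} | A W. openin Z W \<and>
        (\<exists>p\<in>topspace X \<times> topspace Y. \<exists>G.
            openin (subtopology (prod_topology X Y) (cross X Y p)) G \<and>
            A = ((prod_topology X Y) closure_of G) \<inter> cross X Y p)}"

definition S_top :: "'a topology \<Rightarrow> 'b topology \<Rightarrow> 'c topology \<Rightarrow> ('a \<times> 'b \<Rightarrow> 'c) topology" where
  "S_top X Y Z = subtopology (topology_generated_by (cross_open_subbase X Y Z)) (sep_cont X Y Z)"

definition is_base :: "'a topology \<Rightarrow> 'a set set \<Rightarrow> bool" where
  "is_base K \<B> \<longleftrightarrow> (\<forall>B\<in>\<B>. openin K B) \<and>
     (\<forall>U. openin K U \<longrightarrow> (\<exists>\<V>\<subseteq>\<B>. \<Union>\<V> = U))"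

definition disjoint_open_family :: "'a topology \<Rightarrow> 'a set set \<Rightarrow> bool" where
  "disjoint_open_family X \<U> \<longleftrightarrow> (\<forall>U\<in>\<U>. openin X U \<and> U \<noteq> {}) \<and> pairwise disjnt \<U>"

text \<open>w(K) < c#(X), where w(K) = min{|B| : B base of K} and
  c#(X) = sup{|U|^+ : U disjoint open family}; since c#(X) is a supremum,
  w(K) < c#(X) iff w(K) < |U|^+ for some disjoint open family U, iff
  |B| < |U|^+ for some base B and some such U.\<close>
definition weight_lt_sharp_cellularity :: "'k topology \<Rightarrow> 'a topology \<Rightarrow> bool" where
  "weight_lt_sharp_cellularity K X \<longleftrightarrow>
     (\<exists>\<B> \<U>. is_base K \<B> \<and> disjoint_open_family X \<U> \<and> ordLess2 (card_of \<B>) (cardSuc (card_of \<U>)))"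

end

theory Submission
  imports Defs
begin

text \<open>
  If $K$ embeds in $S(X \times Y, Z)$, evaluation is a map $F$ on $K \times X \times Y$ that is jointly
  continuous on $K \times Y$ for each $x$ and continuous in $x$. A Namioka-type argument shows that every
  nonempty open subset of $X$ contains a nonempty open set on which $x$ varies $F$ uniformly by at most
  $1/n$. One point from each member of maximal disjoint families of such sets (over all $n$) yields
  enough sections $F(\cdot, x, \cdot)$ to separate the points of $K$, and each section contributes
  countably many open sets, so $w(K)$ is bounded by the size of countably many disjoint families. By the
  Erdos-Tarski argument a single disjoint family of that size exists.

  Conversely, given disjoint families $(U_i)$ in $X$ and $(V_i)$ in $Y$ with bump functions $\varphi_i$,
  $\psi_i$, and functions $g_i$ separating the points of $K$, map $k$ to
  $\sum_i g_i(k)\,\varphi_i(x)\,\psi_i(y)$; on every cross at most two terms survive.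
\<close>

subsection \<open>Disjoint open families\<close>

text \<open>The weight is compared with a supremum of successors, so what is wanted is one disjoint
  family with at least \<open>w(K)\<close> members. Fragmentation yields a separate maximal family
  for each scale 1/n, and it is not evident that the size of their union is attained by a single
  family; the delicate case is a cardinal of countable cofinality, which is what the Erdos-Tarski
  argument settles. Fragmentation treats \<open>K \<times> Y\<close> as one compact parameter space,
  so each estimate concerns X alone and is repeated with the factors exchanged. In the converse the
  rectangles \<open>U i \<times> V i\<close> may accumulate, and the sum need not be jointly
  continuous on \<open>X \<times> Y\<close>. The cross topology tests only single rows and columns,
  and no two rectangles share a row or a column. As K is compact and the function space Hausdorff, a
  continuous injection is enough.\<close>

lemma maximal_disjoint_open_family:
  assumes P: "\<And>Q. openin X Q \<Longrightarrow> Q \<noteq> {} \<Longrightarrow> \<exists>V. openin X V \<and> V \<noteq> {} \<and> V \<subseteq> Q \<and> P V"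
  shows "\<exists>\<U>. disjoint_open_family X \<U> \<and> (\<forall>U\<in>\<U>. P U) \<and>
    (\<forall>Q. openin X Q \<longrightarrow> Q \<noteq> {} \<longrightarrow> (\<exists>U\<in>\<U>. Q \<inter> U \<noteq> {}))"
proof -
  let ?A = "{\<U>. disjoint_open_family X \<U> \<and> (\<forall>U\<in>\<U>. P U)}"
  have "\<exists>M\<in>?A. \<forall>N\<in>?A. M \<subseteq> N \<longrightarrow> N = M"
  proof (rule subset_Zorn')
    fix C assume C: "subset.chain ?A C"
    then have CA: "disjoint_open_family X A" "\<And>U. U \<in> A \<Longrightarrow> P U" if "A \<in> C" for A
      using that unfolding subset.chain_def by auto
    have "pairwise disjnt (\<Union>C)"
    proof (rule pairwiseI)
      fix U V assume "U \<in> \<Union>C" "V \<in> \<Union>C" "U \<noteq> V"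
      then obtain A B where "A \<in> C" "B \<in> C" "U \<in> A" "V \<in> B" by blast
      then obtain D where "D \<in> C" "U \<in> D" "V \<in> D"
        using C unfolding subset.chain_def by blast
      then show "disjnt U V"
        using CA(1) \<open>U \<noteq> V\<close> unfolding disjoint_open_family_def pairwise_def by blast
    qed
    moreover have "\<forall>U\<in>\<Union>C. openin X U \<and> U \<noteq> {} \<and> P U"
      using CA unfolding disjoint_open_family_def by (metis UnionE)
    ultimately show "\<Union>C \<in> ?A"
      unfolding disjoint_open_family_def by simp
  qed
  then obtain M where M: "M \<in> ?A" "\<forall>N\<in>?A. M \<subseteq> N \<longrightarrow> N = M" ..
  show ?thesis
  proof (intro exI[of _ M] conjI allI impI)
    fix Q assume Q: "openin X Q" "Q \<noteq> {}"
    show "\<exists>U\<in>M. Q \<inter> U \<noteq> {}"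
    proof (rule ccontr)
      assume no: "\<not> ?thesis"
      obtain V where V: "openin X V" "V \<noteq> {}" "V \<subseteq> Q" "P V" using P[OF Q] by blast
      have "insert V M \<in> ?A"
        using M(1) V no unfolding disjoint_open_family_def
        by (auto simp: pairwise_insert disjnt_def)
      then have "V \<in> M" using M(2) by blast
      then show False using no V by blast
    qed
  qed (use M in auto)
qed

text \<open>The second piece has to stay infinite so that the split can be repeated. Separate two
  points of \<open>U\<close>: if the part of \<open>U\<close> around one of them is finite, it is
  closed and can be cut away; otherwise that part is itself the infinite piece.\<close>

lemma Hausdorff_infinite_open_split:
  assumes "Hausdorff_space X" "openin X U" "infinite U"
  shows "\<exists>V W. openin X V \<and> V \<noteq> {} \<and> V \<subseteq> U \<and> openin X W \<and> infinite W \<and> W \<subseteq> U \<and> disjnt V W"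
proof -
  obtain a where "a \<in> U" using assms(3) by (metis finite.emptyI all_not_in_conv)
  moreover have "infinite (U - {a})" using assms(3) by simp
  ultimately obtain b where "b \<in> U" "a \<in> U" "a \<noteq> b" by (metis finite.emptyI all_not_in_conv Diff_iff insertI1)
  then have "a \<in> topspace X" "b \<in> topspace X" using assms(2) openin_subset by blast+
  then obtain A B where AB: "openin X A" "openin X B" "a \<in> A" "b \<in> B" "disjnt A B"
    using assms(1) \<open>a \<noteq> b\<close> unfolding Hausdorff_space_def by meson
  let ?A = "U \<inter> A" and ?B = "U \<inter> B"
  have op: "openin X ?A" "openin X ?B" using AB assms(2) by auto
  show ?thesis
  proof (cases "finite ?B")
    case True
    have "closedin X ?B"
      using True assms(1,2) openin_subset[OF op(2)]
      by (simp add: closedin_Hausdorff_finite)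
    then have "openin X (U - ?B)" using assms(2) by blast
    then show ?thesis using True assms(3) op(2) AB \<open>b \<in> U\<close>
      by (intro exI[of _ ?B] exI[of _ "U - ?B"]) (auto simp: disjnt_def)
  next
    case False
    then show ?thesis using op AB \<open>a \<in> U\<close>
      by (intro exI[of _ ?A] exI[of _ ?B]) (auto simp: disjnt_def)
  qed
qed

text \<open>Repeated splitting cuts off \<open>V n\<close> and continues inside the infinite
  remainder \<open>W n\<close>. The result replaces or supplements families that may be finite, so
  that infinite cardinal arithmetic applies.\<close>

lemma infinite_disjoint_open_family:
  assumes "Hausdorff_space X" "infinite (topspace X)"
  obtains \<U> where "disjoint_open_family X \<U>" "infinite \<U>"
proof -
  let ?P = "\<lambda>(V, W). openin X V \<and> V \<noteq> {} \<and> openin X W \<and> infinite W \<and> disjnt V W"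
  let ?Q = "\<lambda>(V, W) (V', W'). V' \<subseteq> W \<and> W' \<subseteq> W"
  have ex: "\<exists>t. ?P t \<and> ?Q s t" if "?P s" for s
    using that Hausdorff_infinite_open_split[OF assms(1), of "snd s"]
    by (cases s) (simp, blast)
  have ex0: "\<exists>t. ?P t"
    using Hausdorff_infinite_open_split[OF assms(1) openin_topspace assms(2)] by fastforce
  have "\<exists>s. \<forall>n::nat. ?P (s n) \<and> ?Q (s n) (s (Suc n))"
    by (rule dependent_nat_choice[of "\<lambda>n. ?P" "\<lambda>n. ?Q"]) (rule ex0, erule ex)
  then obtain s where "\<forall>n::nat. ?P (s n) \<and> ?Q (s n) (s (Suc n))" ..
  then have s: "?P (s n)" "?Q (s n) (s (Suc n))" for n by simp_all
  define V where "V n = fst (s n)" for n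
  define W where "W n = snd (s n)" for n
  have VW: "openin X (V n)" "V n \<noteq> {}" "disjnt (V n) (W n)" "V (Suc n) \<subseteq> W n" "W (Suc n) \<subseteq> W n" for n
    using s[of n] s(1)[of "Suc n"] unfolding V_def W_def by (auto simp: case_prod_beta)
  have Wdec: "W n \<subseteq> W m" if "m \<le> n" for m n
    using lift_Suc_antimono_le[of W, OF VW(5) that] .
  have dis: "disjnt (V m) (V n)" if less: "m < n" for m n
  proof -
    obtain k where k: "n = Suc k" using less by (cases n) auto
    then have "V n \<subseteq> W m" using VW(4)[of k] Wdec[of m k] less by auto
    then show ?thesis using VW(3)[of m] unfolding disjnt_def by blast
  qed
  have dis': "disjnt (V m) (V n)" if "m \<noteq> n" for m n
    using that dis[of m n] dis[of n m] by (metis disjnt_sym linorder_neqE_nat)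
  have "inj V"
    using dis' VW(2) by (metis disjnt_self_iff_empty injI)
  show thesis
  proof
    show "disjoint_open_family X (range V)"
      using VW(1,2) dis' unfolding disjoint_open_family_def pairwise_def by (metis rangeE)
    show "infinite (range V)" using \<open>inj V\<close> range_inj_infinite by blast
  qed
qed

text \<open>Confining the n-th family to \<open>Q n\<close> keeps the pooled family disjoint and, as
  members are nonempty, makes n recoverable from a member. So pooling loses no cardinality:
  \<open>snd\<close> is injective on the disjoint sum.\<close>

lemma disjoint_open_family_UN:
  fixes \<U> :: "nat \<Rightarrow> 'b set"
  assumes W: "\<And>n. disjoint_open_family X (\<W> n)" "\<And>n W. W \<in> \<W> n \<Longrightarrow> W \<subseteq> Q n"
    and Q: "\<And>m n. m \<noteq> n \<Longrightarrow> disjnt (Q m) (Q n)"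
    and le: "\<And>n::nat. |\<U> n| \<le>o |\<W> n|"
  shows "disjoint_open_family X (\<Union>n. \<W> n)" "|\<Union>n. \<U> n| \<le>o |\<Union>n. \<W> n|"
proof -
  have "pairwise disjnt (\<Union>n. \<W> n)"
  proof (rule pairwiseI)
    fix U V assume UV: "U \<in> (\<Union>n. \<W> n)" "V \<in> (\<Union>n. \<W> n)" "U \<noteq> V"
    then obtain m n where mn: "U \<in> \<W> m" "V \<in> \<W> n" by blast
    show "disjnt U V"
    proof (cases "m = n")
      case True
      then show ?thesis using W(1) mn UV(3) unfolding disjoint_open_family_def pairwise_def by blast
    next
      case False
      then show ?thesis using W(2)[OF mn(1)] W(2)[OF mn(2)] Q[OF False] unfolding disjnt_def by blast
    qed
  qed
  then show "disjoint_open_family X (\<Union>n. \<W> n)"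
    using W(1) unfolding disjoint_open_family_def by blast
  have ne: "U \<noteq> {}" if "U \<in> \<W> n" for U n
    using W(1) that unfolding disjoint_open_family_def by blast
  have "inj_on snd (Sigma UNIV \<W>)"
  proof (rule inj_onI)
    fix a b assume ab: "a \<in> Sigma UNIV \<W>" "b \<in> Sigma UNIV \<W>" "snd a = snd b"
    then have "snd a \<in> \<W> (fst a)" "snd a \<in> \<W> (fst b)" by auto
    have "fst a = fst b"
    proof (rule ccontr)
      assume "fst a \<noteq> fst b"
      then have "disjnt (Q (fst a)) (Q (fst b))" by (rule Q)
      then show False
        using W(2)[OF \<open>snd a \<in> \<W> (fst a)\<close>] W(2)[OF \<open>snd a \<in> \<W> (fst b)\<close>] ne[OF \<open>snd a \<in> \<W> (fst a)\<close>]
        unfolding disjnt_def by blast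
    qed
    then show "a = b" using ab(3) by (simp add: prod_eq_iff)
  qed
  moreover have "snd ` Sigma UNIV \<W> \<subseteq> (\<Union>n. \<W> n)" by auto
  ultimately have 1: "|Sigma UNIV \<W>| \<le>o |\<Union>n. \<W> n|"
    using card_of_ordLeq by blast
  have "|\<Union>n. \<U> n| \<le>o |Sigma UNIV \<U>|" using card_of_UNION_Sigma by blast
  moreover have "|Sigma UNIV \<U>| \<le>o |Sigma UNIV \<W>|" using le by (intro card_of_Sigma_mono1) blast
  ultimately show "|\<Union>n. \<U> n| \<le>o |\<Union>n. \<W> n|"
    using 1 by (metis ordLeq_transitive)
qed

text \<open>Finiteness of \<open>I\<close> is essential: countably many smaller sets can exhaust C
  if its cardinal has countable cofinality. Hence the effort below to show that only finitely many
  ranks occur.\<close>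

lemma card_of_finite_UN_ordLess:
  fixes A :: "'i \<Rightarrow> 'c set"
  assumes "infinite C" "finite I" "\<And>i. i \<in> I \<Longrightarrow> |A i| <o |C|"
  shows "|\<Union>i\<in>I. A i| <o |C|"
  using assms(2,3)
proof (induction I)
  case empty
  have "\<not> |C| \<le>o |{} :: 'c set|" using card_of_ordLeq_finite assms(1) by blast
  then show ?case
    using not_ordLeq_iff_ordLess[OF card_of_Well_order card_of_Well_order, of C "{} :: 'c set"] by simp
next
  case (insert i I)
  then show ?case
    using card_of_Un_ordLess_infinite[OF assms(1), of "A i" "\<Union>i\<in>I. A i"] by simp
qed

text \<open>If every disjoint open family were strictly smaller than the union of the given ones, a
  single infinite set \<open>M\<close>, also strictly smaller, would bound all
  \<open>|\<U> n|\<close> at once. A countable union of sets of size at most \<open>|M|\<close> has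
  size at most \<open>|M|\<close>, a contradiction.\<close>

proposition Erdos_Tarski_omega:
  assumes U: "\<And>n::nat. disjoint_open_family X (\<U> n)" and inf: "infinite (\<U> 0)"
  obtains \<V> where "disjoint_open_family X \<V>" "|\<Union>n. \<U> n| \<le>o |\<V>|"
proof (rule ccontr)
  assume "\<not> thesis"
  with that have small: "|\<V>| <o |\<Union>n. \<U> n|" if "disjoint_open_family X \<V>" for \<V>
    using that by (meson not_ordLeq_iff_ordLess card_of_Well_order)
  define rich where "rich = (\<lambda>Q n. \<exists>\<W>. disjoint_open_family X \<W> \<and> (\<forall>W\<in>\<W>. W \<subseteq> Q) \<and> |\<U> n| \<le>o |\<W>| )"
  have poor: "|\<W>| <o |\<U> n|"
    if "\<not> rich Q n" "disjoint_open_family X \<W>" "\<And>W. W \<in> \<W> \<Longrightarrow> W \<subseteq> Q" for \<W> Q n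
    using that unfolding rich_def by (meson not_ordLeq_iff_ordLess card_of_Well_order)
  \<comment> \<open>Pooling the families hosted by such disjoint \<open>Q n\<close> would give one
    disjoint family as large as the whole union. Both later contradictions are of this kind.\<close>
  have norich: False if "\<And>n. rich (Q n) n" and disj: "\<And>m n. m \<noteq> n \<Longrightarrow> disjnt (Q m) (Q n)" for Q
  proof -
    obtain \<W> where W: "\<And>n. disjoint_open_family X (\<W> n)" "\<And>n W. W \<in> \<W> n \<Longrightarrow> W \<subseteq> Q n"
        "\<And>n. |\<U> n| \<le>o |\<W> n|"
      using \<open>\<And>n. rich (Q n) n\<close> unfolding rich_def by metis
    show False
      using not_ordLess_ordLeq[OF small[OF disjoint_open_family_UN(1)[OF W(1,2) disj W(3)]]]
        disjoint_open_family_UN(2)[OF W(1,2) disj W(3)] by (rule notE)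
  qed
  \<comment> \<open>Below a set all of whose open subsets are rich for all n, infinitely many disjoint rich sets
    could be combined. So the non-rich sets are dense, and a maximal disjoint family of them bounds
    every other disjoint family.\<close>
  have small_dense: "\<exists>V. openin X V \<and> V \<noteq> {} \<and> V \<subseteq> Q \<and> (\<exists>n. \<not> rich V n)" if Q: "openin X Q" "Q \<noteq> {}" for Q
  proof (rule ccontr)
    assume "\<not> ?thesis"
    then have r: "rich V n" if "openin X V" "V \<noteq> {}" "V \<subseteq> Q" for V n using that by blast
    obtain \<W> where W: "disjoint_open_family X \<W>" "\<forall>W\<in>\<W>. W \<subseteq> Q" "|\<U> 0| \<le>o |\<W>|"
      using r[OF Q subset_refl, of 0] unfolding rich_def by blast
    have "infinite \<W>" using W(3) inf card_of_ordLeq_infinite by blast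
    then obtain V :: "nat \<Rightarrow> _" where V: "inj V" "range V \<subseteq> \<W>" using infinite_countable_subset by blast
    show False
    proof (rule norich[of V])
      show "rich (V n) n" for n
        using r[of "V n" n] V(2) W(1,2) unfolding disjoint_open_family_def by blast
      show "disjnt (V m) (V n)" if "m \<noteq> n" for m n
      proof -
        have "V m \<noteq> V n" "V m \<in> \<W>" "V n \<in> \<W>" using that V by (auto dest: injD)
        then show ?thesis using W(1) unfolding disjoint_open_family_def pairwise_def by simp
      qed
    qed
  qed
  obtain \<V> where V: "disjoint_open_family X \<V>" "\<And>V. V \<in> \<V> \<Longrightarrow> \<exists>n. \<not> rich V n"
    and dense: "\<And>Q. openin X Q \<Longrightarrow> Q \<noteq> {} \<Longrightarrow> \<exists>V\<in>\<V>. Q \<inter> V \<noteq> {}"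
    using maximal_disjoint_open_family[where P = "\<lambda>V. \<exists>n. \<not> rich V n", OF small_dense] by metis
  define r where "r V = (LEAST n. \<not> rich V n)" for V
  have r: "\<not> rich V (r V)" if "V \<in> \<V>" for V
    using V(2)[OF that] unfolding r_def by (rule LeastI_ex)
  have r': "rich V n" if "n < r V" for V n
    using that not_less_Least unfolding r_def by blast
  have "finite (r ` \<V>)"
  proof (rule ccontr)
    assume N: "infinite (r ` \<V>)"
    \<comment> \<open>The shift to \<open>Suc n\<close> makes the rank of \<open>R n\<close> at
      least n + 1, and a set is rich at every level below its rank. Distinct ranks give distinct,
      hence disjoint, members of \<open>\<V>\<close>.\<close>
    define R where "R n = inv_into \<V> r (enumerate (r ` \<V>) (Suc n))" for n
    have R: "R n \<in> \<V>" "r (R n) = enumerate (r ` \<V>) (Suc n)" for n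
      unfolding R_def using enumerate_in_set[OF N] by (auto intro: inv_into_into f_inv_into_f)
    show False
    proof (rule norich[of R])
      show "rich (R n) n" for n
        using R(2)[of n] le_enumerate[OF N, of "Suc n"] by (intro r') simp
      show "disjnt (R m) (R n)" if "m \<noteq> n" for m n
      proof -
        have "R m \<noteq> R n"
          using that R(2) strict_mono_enumerate[OF N] by (metis Suc_inject strict_mono_eq)
        then show ?thesis using R(1) V(1) unfolding disjoint_open_family_def pairwise_def by blast
      qed
    qed
  qed
  \<comment> \<open>The traces of any disjoint family on a member V are fewer than
    \<open>\<U> (r V)\<close>, and only finitely many such families occur. The extra
    \<open>\<U> 0\<close> makes \<open>M\<close> infinite.\<close>
  define M where "M = \<V> \<union> (\<Union>n\<in>insert 0 (r ` \<V>). \<U> n)"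
  have infT: "infinite (\<Union>n. \<U> n)" using inf by (meson UN_upper finite_subset UNIV_I)
  have "|M| <o |\<Union>n. \<U> n|"
    unfolding M_def using infT small V(1) U \<open>finite (r ` \<V>)\<close>
    by (intro card_of_Un_ordLess_infinite card_of_finite_UN_ordLess) auto
  moreover have infM: "infinite M" unfolding M_def using inf by simp
  have leM: "|\<U> n| \<le>o |M|" for n
  proof -
    let ?W = "\<lambda>V. {U \<inter> V | U. U \<in> \<U> n \<and> U \<inter> V \<noteq> {}}"
    have W: "disjoint_open_family X (?W V)" if "V \<in> \<V>" for V
      unfolding disjoint_open_family_def
    proof (intro conjI ballI pairwiseI)
      fix A B assume "A \<in> ?W V" "B \<in> ?W V" "A \<noteq> B"
      then obtain U1 U2 where "U1 \<in> \<U> n" "U2 \<in> \<U> n" "A = U1 \<inter> V" "B = U2 \<inter> V" "U1 \<noteq> U2" by blast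
      then show "disjnt A B"
        using U[of n] unfolding disjoint_open_family_def pairwise_def disjnt_def by blast
    qed (use U[of n] V(1) that in \<open>auto simp: disjoint_open_family_def\<close>)
    have "|?W V| \<le>o |M|" if "V \<in> \<V>" for V
    proof -
      have "|?W V| <o |\<U> (r V)|"
        using poor[OF r[OF that] W[OF that]] by blast
      moreover have "|\<U> (r V)| \<le>o |M|"
        using that by (intro card_of_mono1) (auto simp: M_def)
      ultimately show ?thesis using ordLess_imp_ordLeq ordLeq_transitive by blast
    qed
    moreover have "|\<V>| \<le>o |M|" by (intro card_of_mono1) (simp add: M_def)
    ultimately have S: "|SIGMA V:\<V>. ?W V| \<le>o |M|"
      using infM by (intro card_of_Sigma_ordLeq_infinite) auto
    \<comment> \<open>By density every member of \<open>\<U> n\<close> leaves a nonempty trace on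
      some V, and by disjointness a nonempty trace determines the member. So counting traces is
      enough.\<close>
    have "\<forall>U\<in>\<U> n. \<exists>V\<in>\<V>. U \<inter> V \<noteq> {}"
      using U[of n] dense unfolding disjoint_open_family_def by blast
    then obtain v where v: "\<And>U. U \<in> \<U> n \<Longrightarrow> v U \<in> \<V> \<and> U \<inter> v U \<noteq> {}" by metis
    have "inj_on (\<lambda>U. (v U, U \<inter> v U)) (\<U> n)"
    proof (rule inj_onI)
      fix U U' assume U1: "U \<in> \<U> n" "U' \<in> \<U> n" "(v U, U \<inter> v U) = (v U', U' \<inter> v U')"
      then have "U \<inter> U' \<noteq> {}" using v[OF U1(1)] by blast
      then show "U = U'"
        using U[of n] U1 unfolding disjoint_open_family_def pairwise_def disjnt_def by blast
    qed
    moreover have "(v U, U \<inter> v U) \<in> (SIGMA V:\<V>. ?W V)" if "U \<in> \<U> n" for U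
      using v[OF that] that by (intro SigmaI) auto
    ultimately have "|\<U> n| \<le>o |SIGMA V:\<V>. ?W V|" by (rule card_of_ordLeqI)
    then show ?thesis by (rule ordLeq_transitive[OF _ S])
  qed
  have "|\<Union>n. \<U> n| \<le>o |M|"
    using infM leM by (intro card_of_UNION_ordLeq_infinite) (auto simp: infinite_iff_card_of_nat)
  ultimately show False using not_ordLess_ordLeq by blast
qed

subsection \<open>Fragmentation of separately continuous functions\<close>

lemma mdist_self: "x \<in> mspace m \<Longrightarrow> mdist m x x = 0"
  by simp

lemma closedin_mdist_le:
  assumes "continuous_map X (mtopology_of m) f" "continuous_map X (mtopology_of m) g"
  shows "closedin X {x \<in> topspace X. mdist m (f x) (g x) \<le> c}"
  using closedin_continuous_map_preimage[OF continuous_map_mdist[OF assms], of "{..c}"] by simp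

lemma closedin_mdist_ge:
  assumes "continuous_map X (mtopology_of m) f" "continuous_map X (mtopology_of m) g"
  shows "closedin X {x \<in> topspace X. c \<le> mdist m (f x) (g x)}"
  using closedin_continuous_map_preimage[OF continuous_map_mdist[OF assms], of "{c..}"] by simp

lemma openin_mdist_less:
  assumes "continuous_map X (mtopology_of m) f" "continuous_map X (mtopology_of m) g"
  shows "openin X {x \<in> topspace X. mdist m (f x) (g x) < c}"
  using openin_continuous_map_preimage[OF continuous_map_mdist[OF assms], of "{..<c}"] by simp

lemma openin_mdist_greater:
  assumes "continuous_map X (mtopology_of m) f" "continuous_map X (mtopology_of m) g"
  shows "openin X {x \<in> topspace X. c < mdist m (f x) (g x)}"
  using openin_continuous_map_preimage[OF continuous_map_mdist[OF assms], of "{c<..}"] by simp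

lemma continuous_map_const_mspace:
  assumes "continuous_map X (mtopology_of m) f" "x \<in> topspace X"
  shows "continuous_map Y (mtopology_of m) (\<lambda>y. f x)"
  using assms by (auto simp: continuous_map_def)

text \<open>Total boundedness of L in the pseudometric given by the largest distance over the
  finitely many sections in \<open>P\<close>. The case \<open>P = {}\<close> is split off because
  openness of an intersection is obtained for nonempty index sets.\<close>

lemma compact_space_finite_net:
  assumes "compact_space L" "finite P" "\<And>p. p \<in> P \<Longrightarrow> continuous_map L (mtopology_of m) (f p)" "0 < \<eta>"
  obtains R where "finite R" "R \<subseteq> topspace L"
    "\<And>l. l \<in> topspace L \<Longrightarrow> \<exists>r\<in>R. \<forall>p\<in>P. mdist m (f p l) (f p r) < \<eta>"
proof -
  define B where "B r = topspace L \<inter> (\<Inter>p\<in>P. {l \<in> topspace L. mdist m (f p l) (f p r) < \<eta>})" for r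
  have op: "openin L (B r)" if "r \<in> topspace L" for r
  proof (cases "P = {}")
    case False
    then show ?thesis unfolding B_def
      using assms(2,3) that
      by (intro openin_Int openin_topspace openin_Inter)
        (auto intro!: openin_mdist_less intro: continuous_map_const_mspace)
  qed (simp add: B_def)
  have "r \<in> B r" if "r \<in> topspace L" for r
    using that assms(3,4) unfolding B_def
    by (auto simp: continuous_map_def Pi_iff mdist_self)
  then have "topspace L \<subseteq> \<Union>(B ` topspace L)" by blast
  then obtain F where F: "finite F" "F \<subseteq> B ` topspace L" "topspace L \<subseteq> \<Union>F"
    using assms(1) op unfolding compact_space_alt by (metis (no_types, lifting) imageE)
  then obtain R where R: "finite R" "R \<subseteq> topspace L" "F = B ` R"
    by (meson finite_subset_image)
  show thesis
  proof (rule that[OF R(1,2)])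
    fix l assume "l \<in> topspace L"
    then obtain r where "r \<in> R" "l \<in> B r" using F(3) R(3) by blast
    then show "\<exists>r\<in>R. \<forall>p\<in>P. mdist m (f p l) (f p r) < \<eta>" unfolding B_def by auto
  qed
qed

text \<open>When finitely many sections over \<open>P\<close> control all sections over
  \<open>U\<close> up to c, a finite net can stand in for L, and continuity in x at the net points
  produces V. The factor 4 counts the chain from (x,l) via (x,r), (a,r) and (x',r) to
  (x',l).\<close>

lemma oscillation_dichotomy:
  assumes "compact_space L"
    and fL: "\<And>x. x \<in> topspace X \<Longrightarrow> continuous_map L (mtopology_of m) (f x)"
    and fX: "\<And>l. l \<in> topspace L \<Longrightarrow> continuous_map X (mtopology_of m) (\<lambda>x. f x l)"
    and U: "openin X U" "U \<noteq> {}" and P: "finite P" "P \<subseteq> topspace X" and "0 < \<eta>" "0 < c"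
    and near: "\<And>l l' x. l \<in> topspace L \<Longrightarrow> l' \<in> topspace L \<Longrightarrow> x \<in> U \<Longrightarrow>
      (\<And>p. p \<in> P \<Longrightarrow> mdist m (f p l) (f p l') < \<eta>) \<Longrightarrow> mdist m (f x l) (f x l') \<le> c"
  shows "\<exists>V. openin X V \<and> V \<noteq> {} \<and> V \<subseteq> U \<and>
    (\<forall>x\<in>V. \<forall>x'\<in>V. \<forall>l\<in>topspace L. mdist m (f x l) (f x' l) \<le> 4 * c)"
proof -
  obtain R where R: "finite R" "R \<subseteq> topspace L"
    "\<And>l. l \<in> topspace L \<Longrightarrow> \<exists>r\<in>R. \<forall>p\<in>P. mdist m (f p l) (f p r) < \<eta>"
    using compact_space_finite_net[of L P m f \<eta>] assms(1) fL P \<open>0 < \<eta>\<close> by (metis subsetD)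
  obtain a where a: "a \<in> U" using U by blast
  have aX: "a \<in> topspace X" and UX: "U \<subseteq> topspace X" using a U openin_subset by blast+
  have mem: "f x l \<in> mspace m" if "x \<in> topspace X" "l \<in> topspace L" for x l
    using fL[OF that(1)] that(2) by (auto simp: continuous_map_def)
  define V where "V = U \<inter> (\<Inter>r\<in>R. {x \<in> topspace X. mdist m (f x r) (f a r) < c})"
  have "openin X V"
  proof (cases "R = {}")
    case False
    have "openin X {x \<in> topspace X. mdist m (f x r) (f a r) < c}" if "r \<in> R" for r
      using that R(2) fX aX by (intro openin_mdist_less continuous_map_const_mspace[of X m "\<lambda>x. f x r" a]) auto
    then show ?thesis unfolding V_def using False R(1) U(1) by (intro openin_Int openin_Inter) auto
  qed (simp add: V_def U)
  moreover have "a \<in> V"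
    unfolding V_def using a aX mem R(2) \<open>0 < c\<close> by (auto simp: subset_iff mdist_self)
  moreover have "mdist m (f x l) (f x' l) \<le> 4 * c" if x: "x \<in> V" "x' \<in> V" and l: "l \<in> topspace L" for x x' l
  proof -
    obtain r where r: "r \<in> R" "\<forall>p\<in>P. mdist m (f p l) (f p r) < \<eta>" using R(3)[OF l] by blast
    have rL: "r \<in> topspace L" using r R by blast
    have xU: "x \<in> U" "x' \<in> U" using x unfolding V_def by auto
    have "mdist m (f x l) (f x r) \<le> c" "mdist m (f x' l) (f x' r) \<le> c"
      using near[OF l rL] xU r(2) by auto
    moreover have "mdist m (f x r) (f a r) < c" "mdist m (f x' r) (f a r) < c"
      using x r(1) unfolding V_def by auto
    moreover have "f x l \<in> mspace m" "f x' l \<in> mspace m" "f x r \<in> mspace m" "f x' r \<in> mspace m" "f a r \<in> mspace m"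
      using mem xU UX aX l rL by auto
    ultimately show ?thesis
      using mdist_triangle[of "f x l" m "f x r" "f x' l"] mdist_triangle[of "f x r" m "f a r" "f x' l"]
        mdist_triangle[of "f a r" m "f x' r" "f x' l"]
      by (simp add: mdist_commute)
  qed
  ultimately show ?thesis unfolding V_def by (intro exI[of _ V]) (auto simp: V_def)
qed

text \<open>The open set is sought inside an arbitrary \<open>Q\<close> because this density is the
  hypothesis of \<open>maximal_disjoint_open_family\<close>.\<close>

lemma fragmented_by_uniform_distance:
  assumes "compact_space X" "compact_space L"
    and fL: "\<And>x. x \<in> topspace X \<Longrightarrow> continuous_map L (mtopology_of m) (f x)"
    and fX: "\<And>l. l \<in> topspace L \<Longrightarrow> continuous_map X (mtopology_of m) (\<lambda>x. f x l)"
    and Q: "openin X Q" "Q \<noteq> {}" and "0 < e"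
  shows "\<exists>V. openin X V \<and> V \<noteq> {} \<and> V \<subseteq> Q \<and>
    (\<forall>x\<in>V. \<forall>x'\<in>V. \<forall>l\<in>topspace L. mdist m (f x l) (f x' l) \<le> e)"
proof (rule ccontr)
  assume contra: "\<not> ?thesis"
  define c where "c = e / 4"
  have c: "0 < c" "4 * c = e" using \<open>0 < e\<close> by (auto simp: c_def)
  \<comment> \<open>Contrapositive of \<open>oscillation_dichotomy\<close>; \<open>c\<close> is a
    quarter of \<open>e\<close> to match its bound \<open>4 * c\<close>.\<close>
  have step: "\<exists>l l' x. l \<in> topspace L \<and> l' \<in> topspace L \<and> x \<in> U \<and>
      (\<forall>p\<in>P. mdist m (f p l) (f p l') < \<eta>) \<and> c < mdist m (f x l) (f x l')"
    if "openin X U" "U \<noteq> {}" "U \<subseteq> Q" "finite P" "P \<subseteq> topspace X" "0 < \<eta>" for U P \<eta>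
  proof (rule ccontr)
    assume no: "\<not> ?thesis"
    have "\<exists>V. openin X V \<and> V \<noteq> {} \<and> V \<subseteq> U \<and>
      (\<forall>x\<in>V. \<forall>x'\<in>V. \<forall>l\<in>topspace L. mdist m (f x l) (f x' l) \<le> 4 * c)"
    proof (rule oscillation_dichotomy[of L X m f U P \<eta>])
      show "mdist m (f x l) (f x l') \<le> c"
        if "l \<in> topspace L" "l' \<in> topspace L" "x \<in> U" "\<And>p. p \<in> P \<Longrightarrow> mdist m (f p l) (f p l') < \<eta>" for l l' x
        using no that by (meson not_less)
    qed (use assms(2) fL fX that c in auto)
    then show False using contra c(2) \<open>U \<subseteq> Q\<close> by (metis subset_trans)
  qed
  \<comment> \<open>Otherwise build decreasing \<open>U n\<close>, increasing finite \<open>P n\<close>, and pairs \<open>l n\<close>, \<open>l' n\<close> that are almost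
    identified by the sections over \<open>P n\<close> but c-separated by those over \<open>U (Suc n)\<close>. A cluster
    point \<open>a\<close> of the points of \<open>\<Union>n. P n\<close> together with a cluster pair \<open>(b, b')\<close> is contradictory.\<close>
  let ?P = "\<lambda>(U, P). openin X U \<and> U \<noteq> {} \<and> U \<subseteq> Q \<and> finite P \<and> P \<subseteq> topspace X"
  \<comment> \<open>Requiring \<open>P' \<inter> U' \<noteq> {}\<close> puts a collected point into
    every later open set, so that the collected points can cluster in all the nested
    closures.\<close>
  let ?R = "\<lambda>n (U, P) (U', P'). U' \<subseteq> U \<and> P \<subseteq> P' \<and> P' \<inter> U' \<noteq> {} \<and>
      (\<exists>l\<in>topspace L. \<exists>l'\<in>topspace L. (\<forall>p\<in>P. mdist m (f p l) (f p l') < 1 / real (Suc n)) \<and>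
        (\<forall>x\<in>U'. c < mdist m (f x l) (f x l')))"
  have ex: "\<exists>t. ?P t \<and> ?R n s t" if "?P s" for s n
  proof -
    obtain U P where s: "s = (U, P)" by (cases s)
    with that have UP: "openin X U" "U \<noteq> {}" "U \<subseteq> Q" "finite P" "P \<subseteq> topspace X" by auto
    obtain l l' x where l: "l \<in> topspace L" "l' \<in> topspace L" "x \<in> U"
      "\<forall>p\<in>P. mdist m (f p l) (f p l') < 1 / real (Suc n)" "c < mdist m (f x l) (f x l')"
      using step[OF UP, of "1 / real (Suc n)"] by auto
    let ?U = "U \<inter> {x \<in> topspace X. c < mdist m (f x l) (f x l')}"
    have x: "x \<in> topspace X" using l(3) UP(1) openin_subset by blast
    have "openin X ?U"
      using UP(1) fX l by (intro openin_Int openin_mdist_greater) auto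
    then have "?P (?U, insert x P) \<and> ?R n s (?U, insert x P)"
      using UP l x unfolding s by auto
    then show ?thesis by (rule exI[of _ "(?U, insert x P)"])
  qed
  have "\<exists>s. \<forall>n::nat. ?P (s n) \<and> ?R n (s n) (s (Suc n))"
  proof (rule dependent_nat_choice[of "\<lambda>n. ?P" ?R])
    show "\<exists>t. ?P t" using Q by (intro exI[of _ "(Q, {})"]) auto
  qed (erule ex)
  then obtain s where s: "\<forall>n::nat. ?P (s n) \<and> ?R n (s n) (s (Suc n))" ..
  define U where "U n = fst (s n)" for n
  define P where "P n = snd (s n)" for n
  have UP: "openin X (U n)" "finite (P n)" "P n \<subseteq> topspace X"
    "U (Suc n) \<subseteq> U n" "P n \<subseteq> P (Suc n)" "P (Suc n) \<inter> U (Suc n) \<noteq> {}" for n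
    using s[rule_format, of n] unfolding U_def P_def by (auto simp: case_prod_beta)
  have "\<exists>l l'. l \<in> topspace L \<and> l' \<in> topspace L \<and> (\<forall>p\<in>P n. mdist m (f p l) (f p l') < 1 / real (Suc n)) \<and>
        (\<forall>x\<in>U (Suc n). c < mdist m (f x l) (f x l'))" for n
    using s[rule_format, of n] unfolding U_def P_def by (auto simp: case_prod_beta)
  then obtain l l' where l: "\<And>n. l n \<in> topspace L" "\<And>n. l' n \<in> topspace L"
    "\<And>n p. p \<in> P n \<Longrightarrow> mdist m (f p (l n)) (f p (l' n)) < 1 / real (Suc n)"
    "\<And>n x. x \<in> U (Suc n) \<Longrightarrow> c < mdist m (f x (l n)) (f x (l' n))" by metis
  have Udec: "U n \<subseteq> U k" if "k \<le> n" for k n using lift_Suc_antimono_le[of U, OF UP(4) that] .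
  have Pinc: "P k \<subseteq> P n" if "k \<le> n" for k n using lift_Suc_mono_le[of P, OF UP(5) that] .
  define PP where "PP = (\<Union>n. P n)"
  have PPX: "PP \<subseteq> topspace X" unfolding PP_def using UP(3) by blast
  have "(\<Inter>n. X closure_of (PP \<inter> U (Suc n))) \<noteq> {}"
  proof (rule compact_space_imp_nest[OF \<open>compact_space X\<close>])
    show "X closure_of (PP \<inter> U (Suc n)) \<noteq> {}" for n
      using closure_of_subset[of "PP \<inter> U (Suc n)" X] UP(6)[of n] PPX unfolding PP_def by blast
    show "decseq (\<lambda>n. X closure_of (PP \<inter> U (Suc n)))"
      using UP(4) by (intro decseq_SucI closure_of_mono) blast
  qed simp
  then obtain a where a: "\<And>n. a \<in> X closure_of (PP \<inter> U (Suc n))" by blast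
  have aX: "a \<in> topspace X" using a[of 0] by (simp add: in_closure_of)
  \<comment> \<open>Points of \<open>U (Suc n)\<close> separate the n-th pair by more than c. On
    closures this weakens to \<open>c \<le>\<close>, and \<open>a\<close> lies in all of them, so it
    separates every pair.\<close>
  have a_far: "c \<le> mdist m (f a (l n)) (f a (l' n))" for n
  proof -
    have "X closure_of (PP \<inter> U (Suc n)) \<subseteq> {x \<in> topspace X. c \<le> mdist m (f x (l n)) (f x (l' n))}"
      using PPX l(4)[of _ n] fX l(1,2)
      by (intro closure_of_minimal closedin_mdist_ge) (auto intro: less_imp_le)
    then show ?thesis using a[of n] by blast
  qed
  let ?L = "prod_topology L L"
  have cont: "continuous_map ?L (mtopology_of m) (\<lambda>z. f x (fst z))"
    "continuous_map ?L (mtopology_of m) (\<lambda>z. f x (snd z))" if "x \<in> topspace X" for x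
    using continuous_map_compose[OF continuous_map_fst fL[OF that]]
      continuous_map_compose[OF continuous_map_snd fL[OF that]] by (auto simp: o_def)
  \<comment> \<open>The index is shifted since \<open>P 0\<close> may be empty, whereas
    \<open>P (Suc n)\<close> never is; closedness of the intersection needs a nonempty index
    set.\<close>
  define D where "D n = {z \<in> topspace ?L. c \<le> mdist m (f a (fst z)) (f a (snd z))} \<inter>
    (\<Inter>p\<in>P (Suc n). {z \<in> topspace ?L. mdist m (f p (fst z)) (f p (snd z)) \<le> 1 / real (Suc (Suc n))})" for n
  have "(\<Inter>n. D n) \<noteq> {}"
  proof (rule compact_space_imp_nest)
    show "compact_space ?L" using assms(2) by (simp add: compact_space_prod_topology)
    show "closedin ?L (D n)" for n
    proof -
      have "closedin ?L {z \<in> topspace ?L. mdist m (f p (fst z)) (f p (snd z)) \<le> 1 / real (Suc (Suc n))}"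
        if "p \<in> P (Suc n)" for p
        using that UP(3) by (intro closedin_mdist_le cont) auto
      then show ?thesis
        unfolding D_def using UP(6)[of n]
        by (intro closedin_Int closedin_Inter closedin_mdist_ge cont aX) blast+
    qed
    have "(l (Suc n), l' (Suc n)) \<in> D n" for n
      unfolding D_def using l(1,2) a_far l(3)[of _ "Suc n", THEN less_imp_le] by simp
    then show "D n \<noteq> {}" for n by blast
    show "decseq D"
    proof (rule decseq_SucI)
      fix n
      have "1 / real (Suc (Suc (Suc n))) \<le> 1 / real (Suc (Suc n))" by (simp add: field_simps)
      then show "D (Suc n) \<subseteq> D n"
        unfolding D_def using UP(5)[of "Suc n"] by fastforce
    qed
  qed
  then obtain b b' where b: "\<And>n. (b, b') \<in> D n" by auto
  have bL: "b \<in> topspace L" "b' \<in> topspace L" and ab: "c \<le> mdist m (f a b) (f a b')"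
    using b[of 0] unfolding D_def by auto
  have "mdist m (f p b) (f p b') \<le> 0" if p: "p \<in> PP" for p
  proof (rule LIMSEQ_le_const)
    show "(\<lambda>n. 1 / real (Suc (Suc n))) \<longlonglongrightarrow> 0"
      using LIMSEQ_Suc[OF lim_inverse_n'] LIMSEQ_Suc by blast
    obtain k where k: "p \<in> P k" using p unfolding PP_def by blast
    have "mdist m (f p b) (f p b') \<le> 1 / real (Suc (Suc n))" if "k \<le> n" for n
      using b[of n] Pinc[of k "Suc n"] k that unfolding D_def by auto
    then show "\<exists>N. \<forall>n\<ge>N. mdist m (f p b) (f p b') \<le> 1 / real (Suc (Suc n))" by blast
  qed
  \<comment> \<open>All sections over \<open>PP\<close> identify b with b', hence by continuity in x
    so do those over its closure. That closure contains \<open>a\<close>, which separates b and b'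
    by c.\<close>
  then have "X closure_of PP \<subseteq> {x \<in> topspace X. mdist m (f x b) (f x b') \<le> 0}"
    using PPX bL fX by (intro closure_of_minimal closedin_mdist_le) auto
  moreover have "a \<in> X closure_of PP"
    using a[of 0] closure_of_mono[of "PP \<inter> U (Suc 0)" PP X] by blast
  ultimately show False using ab c(1) by auto
qed

subsection \<open>Weight of spaces with separating maps\<close>

lemma card_of_Times_ordLeq_infinite2:
  assumes "infinite T" "|A| \<le>o |T|" "|B| \<le>o |T|"
  shows "|A \<times> B| \<le>o |T|"
  using card_of_Sigma_ordLeq_infinite[of T A "\<lambda>_. B"] assms by blast

lemma is_base_obtain:
  assumes "is_base K \<B>" "openin K U" "k \<in> U"
  obtains B where "B \<in> \<B>" "k \<in> B" "B \<subseteq> U" "openin K B"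
proof -
  obtain \<V> where "\<V> \<subseteq> \<B>" "\<Union>\<V> = U" using assms(1,2) unfolding is_base_def by meson
  then obtain B where "B \<in> \<V>" "k \<in> B" "B \<subseteq> U" "B \<in> \<B>" using assms(3) by blast
  then show thesis using that assms(1) unfolding is_base_def by blast
qed

text \<open>Finite intersections from \<open>\<S>\<close> already form a base: a point of U is
  separated from each point of the compact complement by two members, and finitely many of these
  cover the complement.\<close>

lemma base_from_separating_family:
  assumes "compact_space K" and S: "\<And>A. A \<in> \<S> \<Longrightarrow> openin K A"
    and sep: "\<And>k l. k \<in> topspace K \<Longrightarrow> l \<in> topspace K \<Longrightarrow> k \<noteq> l \<Longrightarrow>
      \<exists>A\<in>\<S>. \<exists>B\<in>\<S>. k \<in> A \<and> l \<in> B \<and> disjnt A B"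
    and T: "infinite T" "|\<S>| \<le>o |T|"
  obtains \<B> where "is_base K \<B>" "|\<B>| \<le>o |T|"
proof -
  \<comment> \<open>Stage n intersects \<open>topspace K\<close> with n members of
    \<open>\<S>\<close>; the staging allows the cardinality to be bounded by induction.\<close>
  define N where "N = rec_nat {topspace K} (\<lambda>_ \<A>. (\<lambda>(A, S). A \<inter> S) ` (\<A> \<times> \<S>))"
  have N: "N 0 = {topspace K}" "N (Suc n) = (\<lambda>(A, S). A \<inter> S) ` (N n \<times> \<S>)" for n
    by (simp_all add: N_def)
  define \<B> where "\<B> = (\<Union>n. N n)"
  have opN: "openin K A" if "A \<in> N n" for A n
    using that by (induction n arbitrary: A) (auto simp: N S)
  have top: "topspace K \<in> \<B>" unfolding \<B>_def using N(1) by blast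
  have int: "A \<inter> S \<in> \<B>" if AS: "A \<in> \<B>" "S \<in> \<S>" for A S
  proof -
    obtain n where "A \<in> N n" using AS unfolding \<B>_def by blast
    then have "A \<inter> S \<in> N (Suc n)" using AS(2) unfolding N(2) by force
    then show ?thesis unfolding \<B>_def by blast
  qed
  have fin: "topspace K \<inter> (\<Inter>l\<in>F. A l) \<in> \<B>" if "finite F" "\<And>l. l \<in> F \<Longrightarrow> A l \<in> \<S>" for A and F :: "'a set"
    using that
  proof (induction F)
    case (insert l F)
    have "topspace K \<inter> (\<Inter>l\<in>F. A l) \<in> \<B>" by (rule insert.IH, rule insert.prems, rule insertI2)
    then have "(topspace K \<inter> (\<Inter>l\<in>F. A l)) \<inter> A l \<in> \<B>" by (rule int) (rule insert.prems, rule insertI1)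
    moreover have "(topspace K \<inter> (\<Inter>l\<in>F. A l)) \<inter> A l = topspace K \<inter> (\<Inter>l\<in>insert l F. A l)" by auto
    ultimately show ?case by simp
  qed (simp add: top)
  have nbhd: "\<exists>B\<in>\<B>. k \<in> B \<and> B \<subseteq> U" if U: "openin K U" "k \<in> U" for k U
  proof -
    have kK: "k \<in> topspace K" using U openin_subset by blast
    have "\<forall>l\<in>topspace K - U. \<exists>A B. A \<in> \<S> \<and> B \<in> \<S> \<and> k \<in> A \<and> l \<in> B \<and> disjnt A B"
      using sep kK U(2) by (metis DiffE)
    then obtain A B where AB: "\<And>l. l \<in> topspace K - U \<Longrightarrow> A l \<in> \<S> \<and> B l \<in> \<S> \<and> k \<in> A l \<and> l \<in> B l \<and> disjnt (A l) (B l)"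
      by metis
    have "compactin K (topspace K - U)"
      using assms(1) U(1) by (intro closedin_compact_space) auto
    moreover have "topspace K - U \<subseteq> \<Union>(B ` (topspace K - U))" using AB by blast
    moreover have "openin K C" if "C \<in> B ` (topspace K - U)" for C using that AB S by blast
    ultimately obtain \<F> where F: "finite \<F>" "\<F> \<subseteq> B ` (topspace K - U)" "topspace K - U \<subseteq> \<Union>\<F>"
      using compactinD[of K "topspace K - U" "B ` (topspace K - U)"] by metis
    then obtain F where F': "finite F" "F \<subseteq> topspace K - U" "\<F> = B ` F" by (meson finite_subset_image)
    let ?B = "topspace K \<inter> (\<Inter>l\<in>F. A l)"
    have "?B \<in> \<B>" using F' AB by (intro fin) auto
    moreover have "k \<in> ?B" using kK F' AB by auto
    moreover have "?B \<subseteq> U"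
    proof
      fix z assume z: "z \<in> ?B"
      show "z \<in> U"
      proof (rule ccontr)
        assume "z \<notin> U"
        then obtain l where "l \<in> F" "z \<in> B l" using z F(3) F'(3) by blast
        moreover have "z \<in> A l" using z \<open>l \<in> F\<close> by blast
        ultimately show False using AB F'(2) unfolding disjnt_def by blast
      qed
    qed
    ultimately show ?thesis by blast
  qed
  have "is_base K \<B>"
    unfolding is_base_def
  proof (intro conjI allI impI ballI)
    show "openin K B" if "B \<in> \<B>" for B using that opN unfolding \<B>_def by blast
    fix U assume "openin K U"
    then have "\<Union>{B \<in> \<B>. B \<subseteq> U} = U" using nbhd by blast
    then show "\<exists>\<V>\<subseteq>\<B>. \<Union>\<V> = U" by (intro exI[of _ "{B \<in> \<B>. B \<subseteq> U}"]) auto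
  qed
  moreover have "|N n| \<le>o |T|" for n
  proof (induction n)
    case 0
    show ?case unfolding N(1) using T(1) by (simp add: card_of_singl_ordLeq infinite_imp_nonempty)
  next
    case (Suc n)
    show ?case unfolding N(2)
      using ordLeq_transitive[OF card_of_image card_of_Times_ordLeq_infinite2[OF T(1) Suc T(2)]] .
  qed
  then have "|\<B>| \<le>o |T|"
    unfolding \<B>_def using T(1)
    by (intro card_of_UNION_ordLeq_infinite) (auto simp: infinite_iff_card_of_nat)
  ultimately show thesis using that by blast
qed

text \<open>The tube lemma: projection along the compact factor \<open>Y\<close> is closed, so the
  parameters with a bad point in \<open>C\<close> form a closed set.\<close>

lemma openin_all_closed_param:
  assumes "compact_space Y" "closedin Y C" "continuous_map (prod_topology K Y) Z f" "openin Z W"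
  shows "openin K {k \<in> topspace K. \<forall>y\<in>C. f (k, y) \<in> W}"
proof -
  let ?D = "{z \<in> topspace (prod_topology K Y). snd z \<in> C} \<inter>
    {z \<in> topspace (prod_topology K Y). f z \<in> topspace Z - W}"
  have "closedin (prod_topology K Y) ?D"
    using closedin_continuous_map_preimage[OF continuous_map_snd assms(2)]
      closedin_continuous_map_preimage[OF assms(3), of "topspace Z - W"] assms(4)
    by (intro closedin_Int) auto
  then have cl: "closedin K (fst ` ?D)"
    using closed_map_fst[OF assms(1)] unfolding closed_map_def by blast
  have img: "fst ` ?D = {k \<in> topspace K. \<exists>y\<in>C. f (k, y) \<notin> W}"
  proof (intro equalityI subsetI)
    fix k assume "k \<in> {k \<in> topspace K. \<exists>y\<in>C. f (k, y) \<notin> W}"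
    then obtain y where ky: "k \<in> topspace K" "y \<in> C" "f (k, y) \<notin> W" by blast
    then have "(k, y) \<in> topspace (prod_topology K Y)" using closedin_subset[OF assms(2)] by auto
    moreover from this have "f (k, y) \<in> topspace Z" using assms(3) by (simp add: continuous_map_def Pi_iff)
    ultimately have "(k, y) \<in> ?D" using ky by auto
    then show "k \<in> fst ` ?D" by force
  qed force
  have compl: "topspace K - {k \<in> topspace K. \<exists>y\<in>C. f (k, y) \<notin> W} = {k \<in> topspace K. \<forall>y\<in>C. f (k, y) \<in> W}"
    by blast
  show ?thesis using openin_diff[OF openin_topspace cl] unfolding img compl .
qed

lemma weight_lt_sharp_cellularityI:
  assumes "is_base K \<B>" "disjoint_open_family X \<U>" "|\<B>| \<le>o |\<U>|"
  shows "weight_lt_sharp_cellularity K X"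
  using assms unfolding weight_lt_sharp_cellularity_def
  by (metis cardSuc_ordLeq_ordLess card_of_Card_order)

text \<open>Continuity is asymmetric because \<open>K \<times> Y\<close> takes the place of L in the
  fragmentation lemma: joint in k and y for fixed x, and separate in x.\<close>

proposition weight_lt_sharp_cellularity_of_separating_maps:
  fixes m :: "'c metric"
  assumes X: "compact_space X" "Hausdorff_space X" "infinite (topspace X)"
    and Y: "compact_space Y" and K: "compact_space K"
    and FK: "\<And>x. x \<in> topspace X \<Longrightarrow>
      continuous_map (prod_topology K Y) (mtopology_of m) (\<lambda>z. F (fst z) x (snd z))"
    and FX: "\<And>k y. k \<in> topspace K \<Longrightarrow> y \<in> topspace Y \<Longrightarrow> continuous_map X (mtopology_of m) (\<lambda>x. F k x y)"
    and sep: "\<And>k l. k \<in> topspace K \<Longrightarrow> l \<in> topspace K \<Longrightarrow> k \<noteq> l \<Longrightarrow>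
      \<exists>x\<in>topspace X. \<exists>y\<in>topspace Y. F k x y \<noteq> F l x y"
  shows "weight_lt_sharp_cellularity K X"
proof -
  have mem: "F k x y \<in> mspace m" if "k \<in> topspace K" "x \<in> topspace X" "y \<in> topspace Y" for k x y
    using FX[of k y] that by (auto simp: continuous_map_def)
  define thin where "thin n V \<longleftrightarrow> (\<forall>x\<in>V. \<forall>x'\<in>V. \<forall>k\<in>topspace K. \<forall>y\<in>topspace Y.
      mdist m (F k x y) (F k x' y) \<le> 1 / real (Suc n))" for n V
  have "\<exists>V. openin X V \<and> V \<noteq> {} \<and> V \<subseteq> Q \<and> thin n V" if Q: "openin X Q" "Q \<noteq> {}" for Q n
  proof -
    have "\<exists>V. openin X V \<and> V \<noteq> {} \<and> V \<subseteq> Q \<and>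
      (\<forall>x\<in>V. \<forall>x'\<in>V. \<forall>z\<in>topspace (prod_topology K Y).
        mdist m (F (fst z) x (snd z)) (F (fst z) x' (snd z)) \<le> 1 / real (Suc n))"
      using X(1) K Y FK FX Q
      by (intro fragmented_by_uniform_distance) (auto simp: compact_space_prod_topology)
    then show ?thesis unfolding thin_def by simp
  qed
  then have "\<exists>\<U>. disjoint_open_family X \<U> \<and> (\<forall>U\<in>\<U>. thin n U) \<and>
    (\<forall>Q. openin X Q \<longrightarrow> Q \<noteq> {} \<longrightarrow> (\<exists>U\<in>\<U>. Q \<inter> U \<noteq> {}))" for n
    by (rule maximal_disjoint_open_family)
  then obtain \<U> where U: "\<And>n. disjoint_open_family X (\<U> n)" "\<And>n U. U \<in> \<U> n \<Longrightarrow> thin n U"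
    "\<And>n Q. openin X Q \<Longrightarrow> Q \<noteq> {} \<Longrightarrow> \<exists>U\<in>\<U> n. Q \<inter> U \<noteq> {}"
    by metis
  obtain \<D> where D: "disjoint_open_family X \<D>" "infinite \<D>"
    using infinite_disjoint_open_family[OF X(2,3)] .
  \<comment> \<open>The fragmentation families may all be finite. An infinite family placed at index
    0 meets the hypothesis of \<open>Erdos_Tarski_omega\<close> and lets \<open>T\<close> absorb
    countable factors.\<close>
  define \<U>' where "\<U>' = case_nat \<D> \<U>"
  have U': "disjoint_open_family X (\<U>' n)" for n
    unfolding \<U>'_def using D(1) U(1) by (simp split: nat.split)
  define T where "T = (\<Union>n. \<U>' n)"
  have "infinite (\<U>' 0)" unfolding \<U>'_def using D(2) by simp
  then obtain \<V> where V: "disjoint_open_family X \<V>" "|T| \<le>o |\<V>|"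
    unfolding T_def using Erdos_Tarski_omega[where \<U> = \<U>', OF U'] by metis
  have "\<D> \<subseteq> T" unfolding T_def \<U>'_def by (metis UN_upper UNIV_I nat.case(1))
  then have infT: "infinite T" using D(2) finite_subset by blast
  have UT: "\<U> n \<subseteq> T" for n unfolding T_def \<U>'_def by (metis UN_upper UNIV_I nat.case(2))
  have "U \<noteq> {} \<and> U \<subseteq> topspace X" if "U \<in> T" for U
    using that U' openin_subset unfolding T_def disjoint_open_family_def by blast
  then obtain p where p: "\<And>U. U \<in> T \<Longrightarrow> p U \<in> U \<and> p U \<in> topspace X" by (metis all_not_in_conv subsetD)
  \<comment> \<open>Balls, uniform in y, of the pseudometric on K induced by the section at x.
    Compactness of Y makes them open, and compactness of K makes finitely many suffice at each
    scale.\<close>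
  define B where "B x n r = {k \<in> topspace K. \<forall>y\<in>topspace Y. mdist m (F k x y) (F r x y) < 1 / real (Suc n)}" for x n r
  have opB: "openin K (B x n r)" if xr: "x \<in> topspace X" "r \<in> topspace K" for x n r
  proof -
    have "continuous_map (prod_topology K Y) (prod_topology K Y) (\<lambda>z. (r, snd z))"
      using xr(2) by (intro continuous_map_pairedI continuous_map_snd) auto
    from continuous_map_compose[OF this FK[OF xr(1)]]
    have "continuous_map (prod_topology K Y) (mtopology_of m) (\<lambda>z. F r x (snd z))"
      by (simp add: o_def)
    from continuous_map_mdist[OF FK[OF xr(1)] this]
    have "openin K {k \<in> topspace K. \<forall>y\<in>topspace Y.
        (\<lambda>z. mdist m (F (fst z) x (snd z)) (F r x (snd z))) (k, y) \<in> {..<1 / real (Suc n)}}"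
      by (rule openin_all_closed_param[OF Y closedin_topspace]) simp
    then show ?thesis unfolding B_def by simp
  qed
  have "\<exists>R. finite R \<and> R \<subseteq> topspace K \<and> topspace K \<subseteq> \<Union>(B x n ` R)" if x: "x \<in> topspace X" for x n
  proof -
    have "r \<in> B x n r" if "r \<in> topspace K" for r
      using that x mem unfolding B_def by (auto simp: mdist_self)
    then have "topspace K \<subseteq> \<Union>(B x n ` topspace K)" by blast
    moreover have "openin K C" if "C \<in> B x n ` topspace K" for C using that opB x by blast
    ultimately obtain \<F> where "finite \<F>" "\<F> \<subseteq> B x n ` topspace K" "topspace K \<subseteq> \<Union>\<F>"
      using compactinD[of K "topspace K" "B x n ` topspace K"] K unfolding compact_space_def by metis
    then show ?thesis by (metis finite_subset_image)
  qed
  then obtain R where R: "\<And>x n. x \<in> topspace X \<Longrightarrow> finite (R x n)" "\<And>x n. x \<in> topspace X \<Longrightarrow> R x n \<subseteq> topspace K"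
    "\<And>x n. x \<in> topspace X \<Longrightarrow> topspace K \<subseteq> \<Union>(B x n ` R x n)" by metis
  define \<S> where "\<S> = (\<Union>U\<in>T. \<Union>n. B (p U) n ` R (p U) n)"
  have "|\<S>| \<le>o |T|"
    unfolding \<S>_def
  proof (intro card_of_UNION_ordLeq_infinite infT ballI)
    show "|UNIV :: nat set| \<le>o |T|" using infT infinite_iff_card_of_nat by blast
    fix U n assume "U \<in> T"
    then have "finite (B (p U) n ` R (p U) n)" using p R(1) by blast
    then show "|B (p U) n ` R (p U) n| \<le>o |T|"
      using infT by (meson card_of_Well_order card_of_ordLeq_finite ordLeq_total)
  qed (rule card_of_mono1[OF subset_refl])
  moreover have "openin K A" if "A \<in> \<S>" for A
    using that opB p R(2) unfolding \<S>_def by blast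
  moreover have "\<exists>A\<in>\<S>. \<exists>B\<in>\<S>. k \<in> A \<and> l \<in> B \<and> disjnt A B"
    if kl: "k \<in> topspace K" "l \<in> topspace K" "k \<noteq> l" for k l
  proof -
    obtain x y where xy: "x \<in> topspace X" "y \<in> topspace Y" "F k x y \<noteq> F l x y" using sep[OF kl] by blast
    define c where "c = mdist m (F k x y) (F l x y)"
    have "c > 0" using xy kl mem unfolding c_def by (simp add: order_less_le)
    \<comment> \<open>Below, six distances of at most 1/(n+1) are added: two for moving from x' to
      a, once for k and once for l, and four through overlapping balls. The bound
      \<open>c / 12\<close> keeps their sum under \<open>c / 2\<close>.\<close>
    then obtain n where n: "1 / real (Suc n) < c / 12" using nat_approx_posE[of "c / 12"] by auto
    let ?Q = "{x \<in> topspace X. c / 2 < mdist m (F k x y) (F l x y)}"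
    have "openin X ?Q" using FX xy kl by (intro openin_mdist_greater) auto
    moreover have "x \<in> ?Q" using xy \<open>c > 0\<close> unfolding c_def by simp
    ultimately obtain U where "U \<in> \<U> n" "?Q \<inter> U \<noteq> {}" using U(3) by (metis (no_types, lifting) empty_iff)
    then obtain x' where x': "x' \<in> U" "x' \<in> topspace X" "c / 2 < mdist m (F k x' y) (F l x' y)" and UT': "U \<in> T"
      using UT by blast
    define a where "a = p U"
    have a: "a \<in> U" "a \<in> topspace X" using p[OF UT'] unfolding a_def by auto
    have near: "mdist m (F j x' y) (F j a y) \<le> 1 / real (Suc n)" if "j \<in> topspace K" for j
      using U(2)[OF \<open>U \<in> \<U> n\<close>] x'(1) a(1) xy(2) that unfolding thin_def by blast
    obtain r s where rs: "r \<in> R a n" "s \<in> R a n" "k \<in> B a n r" "l \<in> B a n s"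
      using R(3)[OF a(2)] kl by blast
    then have rsK: "r \<in> topspace K" "s \<in> topspace K" using R(2)[OF a(2)] by blast+
    have "disjnt (B a n r) (B a n s)"
    proof (rule ccontr)
      assume "\<not> ?thesis"
      then obtain z where z: "z \<in> B a n r" "z \<in> B a n s" unfolding disjnt_def by blast
      then have zK: "z \<in> topspace K" unfolding B_def by blast
      have d: "mdist m (F k a y) (F r a y) < 1 / real (Suc n)" "mdist m (F z a y) (F r a y) < 1 / real (Suc n)"
        "mdist m (F z a y) (F s a y) < 1 / real (Suc n)" "mdist m (F l a y) (F s a y) < 1 / real (Suc n)"
        using rs z xy(2) unfolding B_def by auto
      have M: "F j t y \<in> mspace m" if "j \<in> {k, l, r, s, z}" "t \<in> {a, x'}" for j t
        using that mem kl rsK zK a x' xy by auto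
      show False
        using d near[OF kl(1)] near[OF kl(2)] x'(3) n
          mdist_triangle[of "F k x' y" m "F k a y" "F l x' y"] mdist_triangle[of "F k a y" m "F l a y" "F l x' y"]
          mdist_triangle[of "F k a y" m "F r a y" "F l a y"] mdist_triangle[of "F r a y" m "F z a y" "F l a y"]
          mdist_triangle[of "F z a y" m "F s a y" "F l a y"] M
          mdist_commute[of m "F l a y" "F l x' y"] mdist_commute[of m "F r a y" "F z a y"]
          mdist_commute[of m "F s a y" "F l a y"]
        by simp
    qed
    moreover have "B a n r \<in> \<S>" "B a n s \<in> \<S>" using rs UT' unfolding \<S>_def a_def by blast+
    ultimately show ?thesis using rs by blast
  qed
  ultimately obtain \<B> where "is_base K \<B>" "|\<B>| \<le>o |T|"
    using base_from_separating_family[OF K, of \<S> T] infT by metis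
  then show ?thesis
    using weight_lt_sharp_cellularityI V ordLeq_transitive by metis
qed

subsection \<open>The cross-open topology\<close>

text \<open>Subbasic sets constrain functions on closures, so regularity of the compact factors is
  used to shrink U and V until their closures still map into W. One subbasic set then controls both
  arms of the cross near (a, b).\<close>

lemma S_top_eval_nbhd:
  assumes X: "compact_space X" "Hausdorff_space X" and Y: "compact_space Y" "Hausdorff_space Y"
    and s: "s \<in> sep_cont X Y Z" and ab: "a \<in> topspace X" "b \<in> topspace Y"
    and W: "openin Z W" "s (a, b) \<in> W"
  obtains T U V where "openin (S_top X Y Z) T" "s \<in> T" "openin X U" "a \<in> U" "openin Y V" "b \<in> V"
    "\<And>t x. t \<in> T \<Longrightarrow> x \<in> U \<Longrightarrow> t (x, b) \<in> W" "\<And>t y. t \<in> T \<Longrightarrow> y \<in> V \<Longrightarrow> t (a, y) \<in> W"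
proof -
  have shrink: "\<exists>U. openin S U \<and> c \<in> U \<and> S closure_of U \<subseteq> {x \<in> topspace S. f x \<in> W}"
    if c: "compact_space S" "Hausdorff_space S" "continuous_map S Z f" "c \<in> topspace S" "f c \<in> W"
    for S :: "'x topology" and f c
  proof -
    have "closedin S (topspace S - {x \<in> topspace S. f x \<in> W})"
      using openin_continuous_map_preimage[OF c(3) W(1)] by auto
    moreover have "regular_space S" using c(1,2) compact_Hausdorff_imp_regular_space by blast
    ultimately obtain U where "openin S U" "c \<in> U"
        "disjnt (topspace S - {x \<in> topspace S. f x \<in> W}) (S closure_of U)"
      unfolding regular_space using c(4,5) by (metis (mono_tags, lifting) DiffD2 DiffI mem_Collect_eq)
    then show ?thesis using closure_of_subset_topspace[of S U] unfolding disjnt_def by blast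
  qed
  have sX: "continuous_map X Z (\<lambda>x. s (x, b))" and sY: "continuous_map Y Z (\<lambda>y. s (a, y))"
    using s ab unfolding sep_cont_def by auto
  obtain U where U: "openin X U" "a \<in> U" "X closure_of U \<subseteq> {x \<in> topspace X. s (x, b) \<in> W}"
    using shrink[OF X sX ab(1) W(2)] by blast
  obtain V where V: "openin Y V" "b \<in> V" "Y closure_of V \<subseteq> {y \<in> topspace Y. s (a, y) \<in> W}"
    using shrink[OF Y sY ab(2) W(2)] by blast
  define C where "C = cross X Y (a, b)"
  define G where "G = (U \<times> V) \<inter> C"
  define A where "A = (prod_topology X Y closure_of G) \<inter> C"
  have UX: "U \<subseteq> topspace X" and VY: "V \<subseteq> topspace Y" using U V openin_subset by blast+
  have CXY: "C \<subseteq> topspace X \<times> topspace Y" unfolding C_def cross_def using ab by auto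
  have "openin (subtopology (prod_topology X Y) C) G"
    unfolding G_def openin_subtopology using U(1) V(1) openin_prod_Times_iff by blast
  then have sub: "{t \<in> sep_cont X Y Z. t ` A \<subseteq> W} \<in> cross_open_subbase X Y Z"
    unfolding cross_open_subbase_def A_def C_def using W(1) ab
    by (intro CollectI exI[of _ "(prod_topology X Y closure_of G) \<inter> cross X Y (a, b)"] exI[of _ W]
        conjI bexI[of _ "(a, b)"] exI[of _ G]) auto
  have AUV: "A \<subseteq> (X closure_of U) \<times> (Y closure_of V)"
    unfolding A_def using closure_of_mono[of G "U \<times> V" "prod_topology X Y"]
    by (auto simp: G_def closure_of_Times)
  have GA: "G \<subseteq> A"
    unfolding A_def using closure_of_subset[of G "prod_topology X Y"] CXY G_def by auto
  have sA: "s ` A \<subseteq> W"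
  proof
    fix w assume "w \<in> s ` A"
    then obtain z where z: "z \<in> A" "w = s z" by blast
    then have "z \<in> C" "z \<in> (X closure_of U) \<times> (Y closure_of V)" using AUV unfolding A_def by auto
    then show "w \<in> W" using z(2) U(3) V(3) unfolding C_def cross_def by auto
  qed
  show thesis
  proof
    show "openin (S_top X Y Z) {t \<in> sep_cont X Y Z. t ` A \<subseteq> W}"
      unfolding S_top_def openin_subtopology
      using topology_generated_by_Basis[OF sub] by blast
    show "s \<in> {t \<in> sep_cont X Y Z. t ` A \<subseteq> W}" using s sA by blast
    show "openin X U" "a \<in> U" "openin Y V" "b \<in> V" using U V by auto
    fix t assume t: "t \<in> {t \<in> sep_cont X Y Z. t ` A \<subseteq> W}"
    show "t (x, b) \<in> W" if "x \<in> U" for x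
    proof -
      have "(x, b) \<in> A" using that V(2) UX GA unfolding G_def C_def cross_def by auto
      then show ?thesis using t by blast
    qed
    show "t (a, y) \<in> W" if "y \<in> V" for y
    proof -
      have "(a, y) \<in> A" using that U(2) VY GA unfolding G_def C_def cross_def by auto
      then show ?thesis using t by blast
    qed
  qed
qed

text \<open>A generated topology has only the union of its subbase as carrier. Evaluation at one
  point with \<open>W = topspace Z\<close> shows that every separately continuous function is
  covered.\<close>

lemma topspace_S_top:
  assumes "compact_space X" "Hausdorff_space X" "compact_space Y" "Hausdorff_space Y"
    and "topspace X \<noteq> {}" "topspace Y \<noteq> {}"
  shows "topspace (S_top X Y Z) = sep_cont X Y Z"
proof
  show "topspace (S_top X Y Z) \<subseteq> sep_cont X Y Z" by (simp add: S_top_def)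
  show "sep_cont X Y Z \<subseteq> topspace (S_top X Y Z)"
  proof
    fix s assume s: "s \<in> sep_cont X Y Z"
    obtain a b where ab: "a \<in> topspace X" "b \<in> topspace Y" using assms by blast
    then have "s (a, b) \<in> topspace Z" using s by (auto simp: sep_cont_def continuous_map_def Pi_iff)
    then obtain T where "openin (S_top X Y Z) T" "s \<in> T"
      using S_top_eval_nbhd[OF assms(1-4) s ab openin_topspace] by metis
    then show "s \<in> topspace (S_top X Y Z)" using openin_subset by blast
  qed
qed

lemma Hausdorff_space_S_top:
  assumes "compact_space X" "Hausdorff_space X" "compact_space Y" "Hausdorff_space Y" "Hausdorff_space Z"
  shows "Hausdorff_space (S_top X Y Z)"
  unfolding Hausdorff_space_def
proof (intro allI impI)
  fix s t assume st: "s \<in> topspace (S_top X Y Z) \<and> t \<in> topspace (S_top X Y Z) \<and> s \<noteq> t"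
  then have S: "s \<in> sep_cont X Y Z" "t \<in> sep_cont X Y Z" by (auto simp: S_top_def)
  then have "s \<in> extensional (topspace X \<times> topspace Y)" "t \<in> extensional (topspace X \<times> topspace Y)"
    by (auto simp: sep_cont_def)
  then obtain p where "p \<in> topspace X \<times> topspace Y" "s p \<noteq> t p" using st extensionalityI by blast
  then obtain a b where ab: "a \<in> topspace X" "b \<in> topspace Y" "s (a, b) \<noteq> t (a, b)" by auto
  then have "s (a, b) \<in> topspace Z" "t (a, b) \<in> topspace Z"
    using S by (auto simp: sep_cont_def continuous_map_def Pi_iff)
  then obtain W W' where W: "openin Z W" "openin Z W'" "s (a, b) \<in> W" "t (a, b) \<in> W'" "disjnt W W'"
    using assms(5) ab(3) unfolding Hausdorff_space_def by meson
  obtain T U V where T: "openin (S_top X Y Z) T" "s \<in> T" "a \<in> U" "\<And>t x. t \<in> T \<Longrightarrow> x \<in> U \<Longrightarrow> t (x, b) \<in> W"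
    using S_top_eval_nbhd[OF assms(1-4) S(1) ab(1,2) W(1,3)] by metis
  obtain T' U' V' where T': "openin (S_top X Y Z) T'" "t \<in> T'" "a \<in> U'" "\<And>t x. t \<in> T' \<Longrightarrow> x \<in> U' \<Longrightarrow> t (x, b) \<in> W'"
    using S_top_eval_nbhd[OF assms(1-4) S(2) ab(1,2) W(2,4)] by metis
  have "disjnt T T'"
    using T(4)[OF _ T(3)] T'(4)[OF _ T'(3)] W(5) unfolding disjnt_def by blast
  then show "\<exists>U V. openin (S_top X Y Z) U \<and> openin (S_top X Y Z) V \<and> s \<in> U \<and> t \<in> V \<and> disjnt U V"
    using T(1,2) T'(1,2) by blast
qed

text \<open>With the converse \<open>continuous_map_into_S_topI\<close>, continuity into the
  cross-open topology amounts to joint continuity on K times each row and K times each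
  column.\<close>

lemma continuous_map_into_S_top_joint:
  assumes XY: "compact_space X" "Hausdorff_space X" "compact_space Y" "Hausdorff_space Y"
    and e: "continuous_map K (S_top X Y Z) e"
  shows "a \<in> topspace X \<Longrightarrow> continuous_map (prod_topology K Y) Z (\<lambda>z. e (fst z) (a, snd z))"
    and "b \<in> topspace Y \<Longrightarrow> continuous_map (prod_topology K X) Z (\<lambda>z. e (fst z) (snd z, b))"
proof -
  have S: "e k \<in> sep_cont X Y Z" if "k \<in> topspace K" for k
    using e that by (auto simp: continuous_map_def S_top_def Pi_iff)
  then have Zmem: "e k (x, y) \<in> topspace Z" if "k \<in> topspace K" "x \<in> topspace X" "y \<in> topspace Y" for k x y
    using that by (fastforce simp: sep_cont_def continuous_map_def Pi_iff)
  have nb: "\<exists>N U V. openin K N \<and> k \<in> N \<and> openin X U \<and> a \<in> U \<and> openin Y V \<and> b \<in> V \<and>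
      (\<forall>k'\<in>N. (\<forall>x\<in>U. e k' (x, b) \<in> W) \<and> (\<forall>y\<in>V. e k' (a, y) \<in> W))"
    if k: "k \<in> topspace K" and ab: "a \<in> topspace X" "b \<in> topspace Y" and W: "openin Z W" "e k (a, b) \<in> W" for k a b W
  proof -
    obtain T U V where T: "openin (S_top X Y Z) T" "e k \<in> T" "openin X U" "a \<in> U" "openin Y V" "b \<in> V"
      "\<And>t x. t \<in> T \<Longrightarrow> x \<in> U \<Longrightarrow> t (x, b) \<in> W" "\<And>t y. t \<in> T \<Longrightarrow> y \<in> V \<Longrightarrow> t (a, y) \<in> W"
      using S_top_eval_nbhd[OF XY S[OF k] ab W] by metis
    have "openin K {k \<in> topspace K. e k \<in> T}" using openin_continuous_map_preimage[OF e T(1)] .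
    then show ?thesis using T k by (intro exI[of _ "{k \<in> topspace K. e k \<in> T}"] exI[of _ U] exI[of _ V]) simp
  qed
  show "continuous_map (prod_topology K Y) Z (\<lambda>z. e (fst z) (a, snd z))" if a: "a \<in> topspace X"
    unfolding continuous_map_def
  proof (intro conjI allI impI)
    show "(\<lambda>z. e (fst z) (a, snd z)) \<in> topspace (prod_topology K Y) \<rightarrow> topspace Z"
      using Zmem a by auto
    fix W assume W: "openin Z W"
    show "openin (prod_topology K Y) {z \<in> topspace (prod_topology K Y). e (fst z) (a, snd z) \<in> W}" (is "openin _ ?P")
    proof (subst openin_subopen, intro ballI)
      fix z assume z: "z \<in> ?P"
      then have "fst z \<in> topspace K" "snd z \<in> topspace Y" "e (fst z) (a, snd z) \<in> W" by auto
      then obtain N V where "openin K N" "fst z \<in> N" "openin Y V" "snd z \<in> V" "\<forall>k'\<in>N. \<forall>y\<in>V. e k' (a, y) \<in> W"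
        using nb[OF _ a _ W] by meson
      then have "openin (prod_topology K Y) (N \<times> V)" "z \<in> N \<times> V" "N \<times> V \<subseteq> ?P"
        by (auto simp: openin_prod_Times_iff mem_Times_iff dest: openin_subset[THEN subsetD])
      then show "\<exists>T. openin (prod_topology K Y) T \<and> z \<in> T \<and> T \<subseteq> ?P" by blast
    qed
  qed
  show "continuous_map (prod_topology K X) Z (\<lambda>z. e (fst z) (snd z, b))" if b: "b \<in> topspace Y"
    unfolding continuous_map_def
  proof (intro conjI allI impI)
    show "(\<lambda>z. e (fst z) (snd z, b)) \<in> topspace (prod_topology K X) \<rightarrow> topspace Z"
      using Zmem b by auto
    fix W assume W: "openin Z W"
    show "openin (prod_topology K X) {z \<in> topspace (prod_topology K X). e (fst z) (snd z, b) \<in> W}" (is "openin _ ?P")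
    proof (subst openin_subopen, intro ballI)
      fix z assume z: "z \<in> ?P"
      then have "fst z \<in> topspace K" "snd z \<in> topspace X" "e (fst z) (snd z, b) \<in> W" by auto
      then obtain N U where "openin K N" "fst z \<in> N" "openin X U" "snd z \<in> U" "\<forall>k'\<in>N. \<forall>x\<in>U. e k' (x, b) \<in> W"
        using nb[OF _ _ b W] by meson
      then have "openin (prod_topology K X) (N \<times> U)" "z \<in> N \<times> U" "N \<times> U \<subseteq> ?P"
        by (auto simp: openin_prod_Times_iff mem_Times_iff dest: openin_subset[THEN subsetD])
      then show "\<exists>T. openin (prod_topology K X) T \<and> z \<in> T \<and> T \<subseteq> ?P" by blast
    qed
  qed
qed

lemma continuous_map_into_S_topI:
  assumes X: "compact_space X" "Hausdorff_space X" "topspace X \<noteq> {}"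
    and Y: "compact_space Y" "Hausdorff_space Y" "topspace Y \<noteq> {}"
    and S: "\<And>k. k \<in> topspace K \<Longrightarrow> e k \<in> sep_cont X Y Z"
    and KY: "\<And>a. a \<in> topspace X \<Longrightarrow> continuous_map (prod_topology K Y) Z (\<lambda>z. e (fst z) (a, snd z))"
    and KX: "\<And>b. b \<in> topspace Y \<Longrightarrow> continuous_map (prod_topology K X) Z (\<lambda>z. e (fst z) (snd z, b))"
  shows "continuous_map K (S_top X Y Z) e"
  unfolding S_top_def continuous_map_in_subtopology
proof (intro conjI continuous_on_generated_topo)
  show "e \<in> topspace K \<rightarrow> sep_cont X Y Z" using S by blast
  have "sep_cont X Y Z \<subseteq> \<Union> (cross_open_subbase X Y Z)"
    using topspace_S_top[OF X(1,2) Y(1,2) X(3) Y(3), of Z] by (auto simp: S_top_def)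
  then show "e ` topspace K \<subseteq> \<Union> (cross_open_subbase X Y Z)" using S by blast
  fix Q assume "Q \<in> cross_open_subbase X Y Z"
  then obtain A W a b G where Q: "Q = {s \<in> sep_cont X Y Z. s ` A \<subseteq> W}" "openin Z W"
    and ab: "a \<in> topspace X" "b \<in> topspace Y"
    and A: "A = (prod_topology X Y closure_of G) \<inter> cross X Y (a, b)"
    unfolding cross_open_subbase_def by auto
  let ?G = "prod_topology X Y closure_of G"
  \<comment> \<open>Membership in \<open>Q\<close> splits over the two arms of the cross. On each
    arm \<open>A\<close> traces a closed set, to which the tube lemma applies.\<close>
  let ?A1 = "{y \<in> topspace Y. (a, y) \<in> ?G}" and ?A2 = "{x \<in> topspace X. (x, b) \<in> ?G}"
  have "continuous_map Y (prod_topology X Y) (\<lambda>y. (a, y))" "continuous_map X (prod_topology X Y) (\<lambda>x. (x, b))"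
    using ab by (auto intro!: continuous_map_pairedI)
  then have "closedin Y ?A1" "closedin X ?A2"
    by (auto intro: closedin_continuous_map_preimage)
  then have "openin K {k \<in> topspace K. \<forall>y\<in>?A1. (\<lambda>z. e (fst z) (a, snd z)) (k, y) \<in> W}"
    "openin K {k \<in> topspace K. \<forall>x\<in>?A2. (\<lambda>z. e (fst z) (snd z, b)) (k, x) \<in> W}"
    using openin_all_closed_param[OF Y(1) _ KY[OF ab(1)] Q(2)] openin_all_closed_param[OF X(1) _ KX[OF ab(2)] Q(2)]
    by blast+
  then have "openin K ({k \<in> topspace K. \<forall>y\<in>?A1. e k (a, y) \<in> W} \<inter> {k \<in> topspace K. \<forall>x\<in>?A2. e k (x, b) \<in> W})"
    by (intro openin_Int) simp_all
  moreover have "e -` Q \<inter> topspace K =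
      {k \<in> topspace K. \<forall>y\<in>?A1. e k (a, y) \<in> W} \<inter> {k \<in> topspace K. \<forall>x\<in>?A2. e k (x, b) \<in> W}"
    unfolding Q(1) A using S ab by (auto simp: cross_def image_subset_iff)
  ultimately show "openin K (e -` Q \<inter> topspace K)" by simp
qed

subsection \<open>Embedding by bump functions\<close>

lemma bump_function:
  assumes "compact_space X" "Hausdorff_space X" "openin X U" "U \<noteq> {}"
  shows "\<exists>f a. continuous_map X euclideanreal f \<and> a \<in> U \<and> f a = 1 \<and> (\<forall>x\<in>topspace X - U. f x = 0)"
proof -
  obtain a where a: "a \<in> U" using assms(4) by blast
  then have "a \<in> topspace X" using assms(3) openin_subset by blast
  then have "closedin X {a}" using assms(2) by (simp add: closedin_Hausdorff_finite)
  moreover have "closedin X (topspace X - U)" using assms(3) by blast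
  moreover have "normal_space X" using assms compact_Hausdorff_or_regular_imp_normal_space by blast
  moreover have "disjnt (topspace X - U) {a}" using a by (simp add: disjnt_def)
  ultimately obtain f where f: "continuous_map X (top_of_set {0..1::real}) f"
      "f ` (topspace X - U) \<subseteq> {0}" "f ` {a} \<subseteq> {1}"
    using Urysohn_lemma[of X "topspace X - U" "{a}" 0 1] by auto
  then show ?thesis using a by (intro exI[of _ f] exI[of _ a]) (auto simp: continuous_map_in_subtopology)
qed

text \<open>The selector \<open>\<alpha>\<close> names the only index whose bump can be nonzero at
  x, which lets a possibly infinite sum be written as one term. Outside all \<open>U i\<close> it
  takes the default \<open>i0\<close>.\<close>

lemma bump_functions_sep:
  assumes "compact_space X" "Hausdorff_space X" "i0 \<in> I"
    and U: "\<forall>i\<in>I. openin X (U i) \<and> U i \<noteq> {}" "disjoint_family_on U I"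
  shows "\<exists>\<phi> p \<alpha>.
    (\<forall>i\<in>I. continuous_map X euclideanreal (\<phi> i) \<and> p i \<in> topspace X \<and> \<phi> i (p i) = (1::real)) \<and>
    (\<forall>x. \<alpha> x \<in> I) \<and> (\<forall>i\<in>I. \<forall>x\<in>topspace X. \<phi> i x \<noteq> 0 \<longrightarrow> \<alpha> x = i)"
proof -
  have "\<forall>i\<in>I. \<exists>f a. continuous_map X euclideanreal f \<and> a \<in> U i \<and> f a = 1 \<and> (\<forall>x\<in>topspace X - U i. f x = 0)"
    using bump_function[OF assms(1,2)] U(1) by simp
  then obtain \<phi> p where \<phi>: "\<And>i. i \<in> I \<Longrightarrow> continuous_map X euclideanreal (\<phi> i) \<and> p i \<in> U i \<and> \<phi> i (p i) = 1 \<and>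
      (\<forall>x\<in>topspace X - U i. \<phi> i x = 0)" by metis
  define \<alpha> where "\<alpha> x = (if \<exists>i\<in>I. x \<in> U i then SOME i. i \<in> I \<and> x \<in> U i else i0)" for x
  have \<alpha>: "\<alpha> x \<in> I \<and> x \<in> U (\<alpha> x)" if "\<exists>i\<in>I. x \<in> U i" for x
    using someI_ex[of "\<lambda>i. i \<in> I \<and> x \<in> U i"] that unfolding \<alpha>_def by auto
  show ?thesis
  proof (intro exI conjI allI ballI impI)
    show "\<alpha> x \<in> I" for x
    proof (cases "\<exists>i\<in>I. x \<in> U i")
      case True
      then show ?thesis using \<alpha> by blast
    next
      case False
      then show ?thesis using assms(3) unfolding \<alpha>_def by simp
    qed
    show "\<alpha> x = i" if "i \<in> I" "x \<in> topspace X" "\<phi> i x \<noteq> 0" for i x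
    proof -
      have "x \<in> U i" using that \<phi> by blast
      then have "\<alpha> x \<in> I" "x \<in> U (\<alpha> x)" using \<alpha> that(1) by blast+
      then show ?thesis using U(2) that(1) \<open>x \<in> U i\<close> unfolding disjoint_family_on_def by blast
    qed
    show "p i \<in> topspace X" if "i \<in> I" for i using \<phi>[OF that] U(1) that openin_subset by blast
  qed (use \<phi> in auto)
qed

lemma embedding_map_imp_continuous_inj:
  assumes "embedding_map X Y f"
  shows "continuous_map X Y f" "inj_on f (topspace X)"
  using assms unfolding embedding_map_def homeomorphic_eq_everything_map continuous_map_in_subtopology by auto

proposition embedding_into_S_top:
  assumes X: "compact_space X" "Hausdorff_space X" and Y: "compact_space Y" "Hausdorff_space Y"
    and K: "compact_space K" and Z: "Hausdorff_space Z" and h: "embedding_map euclideanreal Z h"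
    and i0: "i0 \<in> I"
    and U: "\<forall>i\<in>I. openin X (U i) \<and> U i \<noteq> {}" "disjoint_family_on U I"
    and V: "\<forall>i\<in>I. openin Y (V i) \<and> V i \<noteq> {}" "disjoint_family_on V I"
    and g: "\<And>i. i \<in> I \<Longrightarrow> continuous_map K euclideanreal (g i)"
    and sep: "\<And>k l. k \<in> topspace K \<Longrightarrow> l \<in> topspace K \<Longrightarrow> k \<noteq> l \<Longrightarrow> \<exists>i\<in>I. g i k \<noteq> g i l"
  shows "\<exists>e. embedding_map K (S_top X Y Z) e"
proof -
  obtain \<phi> p \<alpha> where
    "\<forall>i\<in>I. continuous_map X euclideanreal (\<phi> i) \<and> p i \<in> topspace X \<and> \<phi> i (p i) = (1::real)"
    "\<forall>x. \<alpha> x \<in> I" "\<forall>i\<in>I. \<forall>x\<in>topspace X. \<phi> i x \<noteq> 0 \<longrightarrow> \<alpha> x = i"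
    using bump_functions_sep[where U = U, OF X i0 U] by (elim exE conjE) (rule that)
  then have \<phi>: "\<And>i. i \<in> I \<Longrightarrow> continuous_map X euclideanreal (\<phi> i)" "\<And>i. i \<in> I \<Longrightarrow> p i \<in> topspace X"
    "\<And>i. i \<in> I \<Longrightarrow> \<phi> i (p i) = 1" "\<And>x. \<alpha> x \<in> I"
    "\<And>i x. i \<in> I \<Longrightarrow> x \<in> topspace X \<Longrightarrow> \<phi> i x \<noteq> 0 \<Longrightarrow> \<alpha> x = i"
    by blast+
  obtain \<psi> q \<beta> where
    "\<forall>i\<in>I. continuous_map Y euclideanreal (\<psi> i) \<and> q i \<in> topspace Y \<and> \<psi> i (q i) = (1::real)"
    "\<forall>x. \<beta> x \<in> I" "\<forall>i\<in>I. \<forall>x\<in>topspace Y. \<psi> i x \<noteq> 0 \<longrightarrow> \<beta> x = i"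
    using bump_functions_sep[where U = V, OF Y i0 V] by (elim exE conjE) (rule that)
  then have \<psi>: "\<And>i. i \<in> I \<Longrightarrow> continuous_map Y euclideanreal (\<psi> i)" "\<And>i. i \<in> I \<Longrightarrow> q i \<in> topspace Y"
    "\<And>i. i \<in> I \<Longrightarrow> \<psi> i (q i) = 1" "\<And>x. \<beta> x \<in> I"
    "\<And>i x. i \<in> I \<Longrightarrow> x \<in> topspace Y \<Longrightarrow> \<psi> i x \<noteq> 0 \<Longrightarrow> \<beta> x = i"
    by blast+
  note hc = embedding_map_imp_continuous_inj[OF h]
  \<comment> \<open>At most one summand of \<open>\<Sum>i\<in>I. g i k * \<phi> i x * \<psi> i y\<close> is nonzero for fixed \<open>x\<close>: the one with
    index \<open>\<alpha> x\<close>; likewise \<open>\<beta> y\<close> for fixed \<open>y\<close>.\<close>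
  define f where "f k x y = g (\<alpha> x) k * (\<phi> (\<alpha> x) x * \<psi> (\<alpha> x) y)" for k x y
  \<comment> \<open>\<open>\<alpha> x\<close> is constant only while x is fixed; for fixed y the
    index must be read from y. If the two indices differ, each formula contains a vanishing
    bump.\<close>
  have f\<beta>: "f k x y = g (\<beta> y) k * (\<phi> (\<beta> y) x * \<psi> (\<beta> y) y)" if "x \<in> topspace X" "y \<in> topspace Y" for k x y
  proof (cases "\<alpha> x = \<beta> y")
    case False
    then have "\<psi> (\<alpha> x) y = 0" "\<phi> (\<beta> y) x = 0" using \<phi>(4,5) \<psi>(4,5) that by metis+
    then show ?thesis by (simp add: f_def)
  qed (simp add: f_def)
  define e where "e k = restrict (\<lambda>(x, y). h (f k x y)) (topspace X \<times> topspace Y)" for k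
  have e: "e k (x, y) = h (f k x y)" if "x \<in> topspace X" "y \<in> topspace Y" for k x y
    using that by (simp add: e_def)
  have jointY: "continuous_map (prod_topology K Y) Z (\<lambda>z. e (fst z) (a, snd z))" if a: "a \<in> topspace X" for a
  proof -
    have "continuous_map (prod_topology K Y) euclideanreal (\<lambda>z. f (fst z) a (snd z))"
      unfolding f_def using \<phi>(4)[of a]
      by (intro continuous_map_real_mult continuous_map_compose[OF continuous_map_fst g, unfolded o_def]
          continuous_map_compose[OF continuous_map_snd \<psi>(1), unfolded o_def]) auto
    from continuous_map_compose[OF this hc(1)]
    show ?thesis by (rule continuous_map_eq) (use a e in auto)
  qed
  have jointX: "continuous_map (prod_topology K X) Z (\<lambda>z. e (fst z) (snd z, b))" if b: "b \<in> topspace Y" for b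
  proof -
    have "continuous_map (prod_topology K X) euclideanreal
        (\<lambda>z. g (\<beta> b) (fst z) * (\<phi> (\<beta> b) (snd z) * \<psi> (\<beta> b) b))"
      using \<psi>(4)[of b]
      by (intro continuous_map_real_mult continuous_map_compose[OF continuous_map_fst g, unfolded o_def]
          continuous_map_compose[OF continuous_map_snd \<phi>(1), unfolded o_def]) auto
    from continuous_map_compose[OF this hc(1)]
    show ?thesis by (rule continuous_map_eq) (use b e f\<beta> in auto)
  qed
  have sc: "e k \<in> sep_cont X Y Z" if k: "k \<in> topspace K" for k
    unfolding sep_cont_def
  proof (intro CollectI conjI ballI)
    show "e k \<in> extensional (topspace X \<times> topspace Y)" by (simp add: e_def)
    show "continuous_map Y Z (\<lambda>y. e k (x, y))" if "x \<in> topspace X" for x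
      using continuous_map_compose[OF _ jointY[OF that], of Y "\<lambda>y. (k, y)"] k
      by (simp add: o_def continuous_map_pairedI)
    show "continuous_map X Z (\<lambda>x. e k (x, y))" if "y \<in> topspace Y" for y
      using continuous_map_compose[OF _ jointX[OF that], of X "\<lambda>x. (k, x)"] k
      by (simp add: o_def continuous_map_pairedI)
  qed
  have "topspace X \<noteq> {}" "topspace Y \<noteq> {}" using \<phi>(2)[OF i0] \<psi>(2)[OF i0] by auto
  then have "continuous_map K (S_top X Y Z) e"
    using X Y sc jointY jointX by (intro continuous_map_into_S_topI) auto
  moreover have "inj_on e (topspace K)"
  proof (rule inj_onI, rule ccontr)
    fix k l assume kl: "k \<in> topspace K" "l \<in> topspace K" "e k = e l" "k \<noteq> l"
    then obtain i where i: "i \<in> I" "g i k \<noteq> g i l" using sep by blast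
    \<comment> \<open>At \<open>(p i, q i)\<close> both bumps are 1, so \<open>e k\<close> takes the
      value \<open>h (g i k)\<close> there, and h is injective.\<close>
    have "\<alpha> (p i) = i" using \<phi>(5)[OF i(1) \<phi>(2)[OF i(1)]] \<phi>(3)[OF i(1)] by simp
    then have "f j (p i) (q i) = g i j" for j using \<phi>(3) \<psi>(3) i(1) by (simp add: f_def)
    moreover have "h (f k (p i) (q i)) = h (f l (p i) (q i))"
      using kl(3) e[OF \<phi>(2)[OF i(1)] \<psi>(2)[OF i(1)]] by metis
    ultimately show False using i(2) hc(2) by (simp add: inj_on_eq_iff)
  qed
  ultimately show ?thesis
    using continuous_imp_embedding_map[OF _ K Hausdorff_space_S_top[OF X Y Z]] by blast
qed

text \<open>Two base sets are enough to name a Urysohn function: one around k whose closure lies in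
  the other, and the other missing l. Hence pairs as indices, which costs nothing against an
  infinite cardinal.\<close>

lemma separating_functions_of_base:
  assumes K: "compact_space K" "Hausdorff_space K" and B: "is_base K \<B>"
  obtains g :: "'k set \<times> 'k set \<Rightarrow> 'k \<Rightarrow> real" where "\<And>i. continuous_map K euclideanreal (g i)"
    "\<And>k l. k \<in> topspace K \<Longrightarrow> l \<in> topspace K \<Longrightarrow> k \<noteq> l \<Longrightarrow> \<exists>i\<in>\<B> \<times> \<B>. g i k \<noteq> g i l"
proof -
  define P where "P i f \<longleftrightarrow> continuous_map K euclideanreal f \<and>
    (\<forall>k\<in>K closure_of (fst i). f k = 0) \<and> (\<forall>k\<in>topspace K - snd i. f k = (1::real))" for i f
  \<comment> \<open>Pairs that admit no such function receive the zero function, so that every index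
    gives a continuous map.\<close>
  define g where "g i = (if \<exists>f. P i f then SOME f. P i f else (\<lambda>_. 0))" for i
  have Pg: "P i (g i)" if "\<exists>f. P i f" for i using someI_ex[OF that] that unfolding g_def by simp
  show thesis
  proof
    show "continuous_map K euclideanreal (g i)" for i
    proof (cases "\<exists>f. P i f")
      case True
      then show ?thesis using Pg unfolding P_def by blast
    qed (simp add: g_def)
    fix k l assume kl: "k \<in> topspace K" "l \<in> topspace K" "k \<noteq> l"
    have "closedin K {l}" using K(2) kl by (simp add: closedin_Hausdorff_finite)
    then have op: "openin K (topspace K - {l})" by blast
    obtain B2 where B2: "B2 \<in> \<B>" "k \<in> B2" "B2 \<subseteq> topspace K - {l}" "openin K B2"
      using is_base_obtain[OF B op] kl by blast
    have clB2: "closedin K (topspace K - B2)" using B2(4) by blast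
    moreover have "k \<in> topspace K - (topspace K - B2)" using kl B2 by blast
    moreover have "regular_space K" using K compact_Hausdorff_imp_regular_space by blast
    ultimately obtain N where N: "openin K N" "k \<in> N" "disjnt (topspace K - B2) (K closure_of N)"
      unfolding regular_space by meson
    obtain B1 where B1: "B1 \<in> \<B>" "k \<in> B1" "B1 \<subseteq> N" "openin K B1"
      using is_base_obtain[OF B N(1,2)] by blast
    have dis: "disjnt (K closure_of B1) (topspace K - B2)"
      using N(3) closure_of_mono[OF B1(3), of K] unfolding disjnt_def by blast
    have "normal_space K" using K compact_Hausdorff_or_regular_imp_normal_space by blast
    then obtain f where "continuous_map K (top_of_set {0..1::real}) f"
        "f ` (K closure_of B1) \<subseteq> {0}" "f ` (topspace K - B2) \<subseteq> {1}"
      using Urysohn_lemma[OF _ closedin_closure_of clB2 dis zero_le_one] by blast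
    then have "P (B1, B2) f" unfolding P_def by (auto simp: continuous_map_in_subtopology)
    then have "P (B1, B2) (g (B1, B2))" using Pg by blast
    moreover have "k \<in> K closure_of B1" using B1 kl closure_of_subset[of B1 K] openin_subset by blast
    ultimately have "g (B1, B2) k = 0" "g (B1, B2) l = 1" using B2(3) kl unfolding P_def by auto
    then show "\<exists>i\<in>\<B> \<times> \<B>. g i k \<noteq> g i l" using B1(1) B2(1) by (intro bexI[of _ "(B1, B2)"]) auto
  qed
qed

text \<open>A finite \<open>\<U>\<close> could be too small to be indexed by pairs. It is exchanged
  for an infinite family, whose cardinal absorbs the square and the extra element
  \<open>B\<close>.\<close>

lemma indexed_disjoint_open_sets:
  assumes X: "Hausdorff_space X" "infinite (topspace X)"
    and U: "disjoint_open_family X \<U>" "|\<B>| \<le>o |\<U>|"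
  obtains u where "\<forall>i\<in>insert B \<B> \<times> insert B \<B>. openin X (u i) \<and> u i \<noteq> {}"
    "disjoint_family_on u (insert B \<B> \<times> insert B \<B>)"
proof -
  obtain \<V> where V: "disjoint_open_family X \<V>" "infinite \<V>" "|\<B>| \<le>o |\<V>|"
  proof (cases "finite \<U>")
    case True
    obtain \<D> where D: "disjoint_open_family X \<D>" "infinite \<D>" using infinite_disjoint_open_family[OF X] .
    have "|\<U>| \<le>o |\<D>|"
      using True D(2) card_of_Well_order card_of_ordLeq_finite ordLeq_total by metis
    then show thesis using that[OF D] U(2) ordLeq_transitive by metis
  qed (use U that in blast)
  have "|{B}| \<le>o |\<V>|" using V(2) by (simp add: card_of_singl_ordLeq infinite_imp_nonempty)
  then have "|insert B \<B>| \<le>o |\<V>|"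
    using card_of_Un_ordLeq_infinite_Field[of "|\<V>|" "{B}" \<B>] V(2,3)
    by (simp add: card_of_Card_order del: Field_card_of) (simp add: Field_card_of)
  then have "|insert B \<B> \<times> insert B \<B>| \<le>o |\<V>|"
    using card_of_Times_ordLeq_infinite2 V(2) by blast
  then obtain u where u: "inj_on u (insert B \<B> \<times> insert B \<B>)" "u ` (insert B \<B> \<times> insert B \<B>) \<subseteq> \<V>"
    unfolding card_of_ordLeq[symmetric] by blast
  show thesis
  proof (rule that)
    show "\<forall>i\<in>insert B \<B> \<times> insert B \<B>. openin X (u i) \<and> u i \<noteq> {}"
      using V(1) u(2) unfolding disjoint_open_family_def by blast
    show "disjoint_family_on u (insert B \<B> \<times> insert B \<B>)"
      unfolding disjoint_family_on_def
    proof (intro ballI impI)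
      fix i j assume ij: "i \<in> insert B \<B> \<times> insert B \<B>" "j \<in> insert B \<B> \<times> insert B \<B>" "i \<noteq> j"
      then have "u i \<noteq> u j" using inj_onD[OF u(1), of i j] by blast
      moreover have "u i \<in> \<V>" "u j \<in> \<V>" using u(2) ij by blast+
      ultimately show "u i \<inter> u j = {}"
        using V(1) unfolding disjoint_open_family_def pairwise_def disjnt_def by simp
    qed
  qed
qed

theorem theorem7p1:
  fixes X :: "'a topology" and Y :: "'b topology" and Z :: "'c topology" and K :: "'k topology"
  assumes "compact_space X" "Hausdorff_space X" "infinite (topspace X)"
    and "compact_space Y" "Hausdorff_space Y" "infinite (topspace Y)"
    and "metrizable_space Z"
    and "\<exists>h. embedding_map euclideanreal Z h"
    and "compact_space K" "Hausdorff_space K"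
  shows "(\<exists>e. embedding_map K (S_top X Y Z) e) \<longleftrightarrow>
           (weight_lt_sharp_cellularity K X \<and> weight_lt_sharp_cellularity K Y)"
proof
  assume "\<exists>e. embedding_map K (S_top X Y Z) e"
  then obtain e where "embedding_map K (S_top X Y Z) e" ..
  note e = embedding_map_imp_continuous_inj[OF this]
  obtain M d where "Metric_space M d" "Z = Metric_space.mtopology M d"
    using assms(7) unfolding metrizable_space_def by blast
  then have "Z = mtopology_of (metric (M, d))" by (simp add: Metric_space.mtopology_of)
  then obtain m where Z: "Z = mtopology_of m" ..
  have S: "e k \<in> sep_cont X Y Z" if "k \<in> topspace K" for k
    using e(1) that by (auto simp: continuous_map_def S_top_def Pi_iff)
  have sep: "\<exists>x\<in>topspace X. \<exists>y\<in>topspace Y. e k (x, y) \<noteq> e l (x, y)"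
    if kl: "k \<in> topspace K" "l \<in> topspace K" "k \<noteq> l" for k l
  proof -
    have "e k \<noteq> e l" using e(2) kl by (simp add: inj_on_eq_iff)
    moreover have "e k \<in> extensional (topspace X \<times> topspace Y)" "e l \<in> extensional (topspace X \<times> topspace Y)"
      using S kl by (auto simp: sep_cont_def)
    ultimately obtain p where "p \<in> topspace X \<times> topspace Y" "e k p \<noteq> e l p" using extensionalityI by blast
    then show ?thesis by auto
  qed
  note joint = continuous_map_into_S_top_joint[OF assms(1,2,4,5) e(1)]
  have sections: "continuous_map X (mtopology_of m) (\<lambda>x. e k (x, y))" "continuous_map Y (mtopology_of m) (\<lambda>y. e k (x, y))"
    if "k \<in> topspace K" "x \<in> topspace X" "y \<in> topspace Y" for k x y
    using S[OF that(1)] that unfolding sep_cont_def Z by auto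
  have nonempty: "topspace X \<noteq> {}" "topspace Y \<noteq> {}" using assms(3,6) by auto
  have "weight_lt_sharp_cellularity K X"
    by (rule weight_lt_sharp_cellularity_of_separating_maps[where F = "\<lambda>k x y. e k (x, y)" and m = m, OF assms(1-4,9)])
      (use joint(1) sections sep nonempty Z in \<open>blast+\<close>)
  moreover have "weight_lt_sharp_cellularity K Y"
    by (rule weight_lt_sharp_cellularity_of_separating_maps[where F = "\<lambda>k y x. e k (x, y)" and m = m, OF assms(4-6,1,9)])
      (use joint(2) sections sep nonempty Z in \<open>blast+\<close>)
  ultimately show "weight_lt_sharp_cellularity K X \<and> weight_lt_sharp_cellularity K Y" ..
next
  assume "weight_lt_sharp_cellularity K X \<and> weight_lt_sharp_cellularity K Y"
  then obtain \<B>1 \<B>2 \<U> \<V> where B: "is_base K \<B>1" "is_base K \<B>2"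
    and U: "disjoint_open_family X \<U>" "|\<B>1| \<le>o |\<U>|" and V: "disjoint_open_family Y \<V>" "|\<B>2| \<le>o |\<V>|"
    unfolding weight_lt_sharp_cellularity_def
    by (metis cardSuc_ordLeq_ordLess card_of_Card_order)
  \<comment> \<open>The two hypotheses may come with different bases. The smaller one fits both
    families, so a single index set serves X and Y.\<close>
  obtain \<B> where \<B>: "is_base K \<B>" "|\<B>| \<le>o |\<U>|" "|\<B>| \<le>o |\<V>|"
  proof (cases "|\<B>1| \<le>o |\<B>2|")
    case True
    then show thesis using that[OF B(1) U(2)] V(2) ordLeq_transitive by metis
  next
    case False
    then have "|\<B>2| \<le>o |\<B>1|" using ordLeq_total card_of_Well_order by metis
    then show thesis using that[OF B(2) _ V(2)] U(2) ordLeq_transitive by metis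
  qed
  \<comment> \<open>Inserting the empty set keeps the index set nonempty when \<open>K\<close> is empty.\<close>
  let ?I = "insert {} \<B> \<times> insert {} \<B>"
  obtain u where u: "\<forall>i\<in>?I. openin X (u i) \<and> u i \<noteq> {}" "disjoint_family_on u ?I"
    using indexed_disjoint_open_sets[OF assms(2,3) U(1) \<B>(2)] .
  obtain v where v: "\<forall>i\<in>?I. openin Y (v i) \<and> v i \<noteq> {}" "disjoint_family_on v ?I"
    using indexed_disjoint_open_sets[OF assms(5,6) V(1) \<B>(3)] .
  obtain g where g: "\<And>i. continuous_map K euclideanreal (g i)"
    "\<And>k l. k \<in> topspace K \<Longrightarrow> l \<in> topspace K \<Longrightarrow> k \<noteq> l \<Longrightarrow> \<exists>i\<in>\<B> \<times> \<B>. g i k \<noteq> g i l"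
    using separating_functions_of_base[OF assms(9,10) \<B>(1)] by metis
  obtain h where h: "embedding_map euclideanreal Z h" using assms(8) ..
  have "\<exists>i\<in>?I. g i k \<noteq> g i l" if "k \<in> topspace K" "l \<in> topspace K" "k \<noteq> l" for k l
    using g(2)[OF that] by blast
  moreover have "({}, {}) \<in> ?I" by blast
  ultimately show "\<exists>e. embedding_map K (S_top X Y Z) e"
    by (intro embedding_into_S_top[where U = u and V = v and g = g and I = ?I,
          OF assms(1,2,4,5,9) metrizable_imp_Hausdorff_space[OF assms(7)] h _ u v g(1)])
qed

end
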